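(* For every real $q\ge1$ and every $n\ge1$, $P_n(132,q)\le P_n(123,q)$, and consequently $\rho(132,q)\le\rho(123,q)$ for $q\ge1$. Equivalently, for every $0<q\le1$ and every $n$, $P_n(231,q)\le P_n(321,q)$, and so $\rho(231,q)\le\rho(321,q)$ for $0<q\le 1$.
   Context: For $q>0$, the Mallows($q$) distribution on $\mathcal{S}_n$ (permutations of $[n]$) gives $\pi$ probability $q^{\operatorname{inv}(\pi)}/[n]_q!$, where $\operatorname{inv}(\pi)$ is the number of inversions, $[n]_q=1+q+\dots+q^{n-1}$, $[n]_q!=[1]_q\cdots[n]_q$. A permutation $\pi\in\mathcal{S}_n$ avoids $\sigma\in\mathcal{S}_m$ (consecutively) if no $m$ consecutive entries $\pi_j\dots\pi_{j+m-1}$ are order-isomorphic to $\sigma$. $P_n(\sigma,q)$ is the probability that a Mallows($q$) permutation of length $n$ avoids $\sigma$, and $\rho(\sigma,q)=\lim_{n\to\infty}P_n(\sigma,q)^{1/n}$ (this limit exists). *)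

theory Defs
  imports Complex_Main "HOL-Combinatorics.Multiset_Permutations"
begin

(* Permutations of [n] are in one-line notation: the elements of permutations_of_set {1..n}.
   List positions are counted from 0. *)

definition inv_count :: "nat list \<Rightarrow> nat" where
  "inv_count \<pi> = card {(i, j). i < j \<and> j < length \<pi> \<and> \<pi> ! i > \<pi> ! j}"

definition q_int :: "nat \<Rightarrow> real \<Rightarrow> real" where
  "q_int n q = (\<Sum>i<n. q ^ i)"

definition q_fact :: "nat \<Rightarrow> real \<Rightarrow> real" where
  "q_fact n q = (\<Prod>k=1..n. q_int k q)"

definition mallows_prob :: "nat \<Rightarrow> real \<Rightarrow> nat list \<Rightarrow> real" where
  "mallows_prob n q \<pi> = q ^ inv_count \<pi> / q_fact n q"

definition order_isomorphic :: "nat list \<Rightarrow> nat list \<Rightarrow> bool" where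
  "order_isomorphic xs ys \<longleftrightarrow> length xs = length ys \<and>
     (\<forall>i<length xs. \<forall>j<length xs. xs ! i < xs ! j \<longleftrightarrow> ys ! i < ys ! j)"

definition avoids :: "nat list \<Rightarrow> nat list \<Rightarrow> bool" where
  "avoids \<pi> \<sigma> \<longleftrightarrow>
     \<not> (\<exists>j. j + length \<sigma> \<le> length \<pi> \<and>
           order_isomorphic (take (length \<sigma>) (drop j \<pi>)) \<sigma>)"

definition avoid_prob :: "nat \<Rightarrow> nat list \<Rightarrow> real \<Rightarrow> real" where
  "avoid_prob n \<sigma> q =
     (\<Sum>\<pi> | \<pi> \<in> permutations_of_set {1..n} \<and> avoids \<pi> \<sigma>. mallows_prob n q \<pi>)"

definition growth_rate :: "nat list \<Rightarrow> real \<Rightarrow> real" where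
  "growth_rate \<sigma> q = lim (\<lambda>n. root n (avoid_prob n \<sigma> q))"

end

theory Submission
  imports Defs
begin

text \<open>
  Let \<open>G n x\<close> (\<open>start_weight q n x\<close> below) be the total weight \<open>q ^ inv\<close> of the 132-avoiding
  permutations of length \<open>n\<close> whose first letter has rank \<open>x\<close>, counted from 0. Prepending a
  letter \<open>x\<close> to a 132-avoider creates an occurrence only if it begins with \<open>a > c > x\<close>, and then deleting \<open>a\<close> leaves an arbitrary
  132-avoider starting with \<open>c\<close>. This yields a closed recursion for \<open>G\<close>.

  A 123-avoider starting with \<open>x\<close> is obtained by prepending \<open>x\<close> to one starting with a smaller
  letter, or by prepending \<open>x, a\<close> with \<open>a > x\<close> to one starting with a letter below \<open>a\<close>. So if
  \<open>G\<close> is a subsolution of this second recursion, then by induction \<open>G\<close> is a lower bound for the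
  123-avoiders with prescribed first letter. Unfolding the recursion of \<open>G\<close> twice and bounding \<open>G\<close>
  from below by the words that begin with a descent turns the subsolution property into the
  nonnegativity of a combination of values of \<open>G\<close>, all of whose coefficients are nonnegative for
  \<open>q \<ge> 1\<close> (lemmas \<open>triple_sum_ge\<close> and \<open>tail_sum_ge\<close>).

  The growth rates exist by Fekete's lemma, since the relative orders of two disjoint blocks of
  consecutive positions are independent, and reversal exchanges \<open>q\<close> and \<open>1 / q\<close>.
\<close>

subsection \<open>Sums of powers of \<open>q\<close>\<close>

definition qsum :: "real \<Rightarrow> nat \<Rightarrow> nat \<Rightarrow> real" where
  "qsum q i j = (\<Sum>k\<in>{i..<j}. q ^ k)"

lemma qsum_empty [simp]: "j \<le> i \<Longrightarrow> qsum q i j = 0"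
  by (simp add: qsum_def)

lemma qsum_Suc: "i \<le> j \<Longrightarrow> qsum q i (Suc j) = qsum q i j + q ^ j"
  by (simp add: qsum_def)

lemma qsum_rec: "i < j \<Longrightarrow> qsum q i j = q ^ i + qsum q (Suc i) j"
  by (simp add: qsum_def sum.atLeast_Suc_lessThan)

lemma qsum_shift: "qsum q (Suc i) (Suc j) = q * qsum q i j"
  unfolding qsum_def by (subst sum.shift_bounds_Suc_ivl) (simp add: sum_distrib_left)

lemma qsum_nonneg: "0 \<le> q \<Longrightarrow> 0 \<le> qsum q i j"
  by (simp add: qsum_def sum_nonneg)

lemma qsum_mono: "0 \<le> q \<Longrightarrow> i' \<le> i \<Longrightarrow> j \<le> j' \<Longrightarrow> qsum q i j \<le> qsum q i' j'"
  unfolding qsum_def by (rule sum_mono2) auto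

lemma qsum_split: "i \<le> j \<Longrightarrow> j \<le> k \<Longrightarrow> qsum q i k = qsum q i j + qsum q j k"
  by (simp add: qsum_def sum.atLeastLessThan_concat)

text \<open>The complete homogeneous symmetric polynomial h2 in the variables q^x, ..., q^(y-1), its
  pairs grouped by their larger index.\<close>

definition qsum2 :: "real \<Rightarrow> nat \<Rightarrow> nat \<Rightarrow> real" where
  "qsum2 q x y = (\<Sum>b\<in>{x..<y}. q ^ b * qsum q x (Suc b))"

lemma qsum2_empty [simp]: "y \<le> x \<Longrightarrow> qsum2 q x y = 0"
  by (simp add: qsum2_def)

lemma qsum2_Suc: "x \<le> y \<Longrightarrow> qsum2 q x (Suc y) = qsum2 q x y + q ^ y * qsum q x (Suc y)"
  by (simp add: qsum2_def)

text \<open>In terms of symmetric functions h1^2 = 2 h2 - p2, and the power sum p2 is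
  nonnegative.\<close>

lemma qsum2_ge:
  assumes "0 \<le> q" "x \<le> y"
  shows "(qsum q x y)\<^sup>2 \<le> 2 * qsum2 q x y"
  using assms(2)
proof (induction y rule: dec_induct)
  case (step y)
  have "(qsum q x (Suc y))\<^sup>2 = (qsum q x y)\<^sup>2 + 2 * q ^ y * qsum q x y + q ^ y * q ^ y"
    using step by (simp add: qsum_Suc power2_eq_square algebra_simps)
  also have "\<dots> \<le> 2 * qsum2 q x y + 2 * (q ^ y * qsum q x y) + 2 * (q ^ y * q ^ y)"
    using step assms(1) by (intro add_mono) auto
  finally show ?case
    using step by (simp add: qsum2_Suc qsum_Suc algebra_simps)
qed simp

lemma qsum2_nonneg: "0 \<le> q \<Longrightarrow> 0 \<le> qsum2 q x y"
  by (simp add: qsum2_def sum_nonneg qsum_nonneg)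

text \<open>The difference of the two sides is h2 of the upper block of variables, which is
  nonnegative.\<close>

lemma qsum2_add_ge:
  assumes "0 \<le> q" "x \<le> y" "y \<le> z"
  shows "qsum2 q x y + qsum q x y * qsum q y z \<le> qsum2 q x z"
  using assms(3)
proof (induction z rule: dec_induct)
  case (step z)
  have "q ^ z * qsum q x y \<le> q ^ z * qsum q x (Suc z)"
    using step assms by (intro mult_left_mono qsum_mono) auto
  with step assms show ?case
    by (simp add: qsum2_Suc qsum_Suc algebra_simps)
qed simp

text \<open>The first \<open>qsum\<close> is q times \<open>qsum q b n\<close>. Cutting it at
  \<open>y\<close> and summing over \<open>b\<close> gives q h2 plus q times the product of the
  block sums; the subtracted part sums to h2.\<close>

lemma weighted_gap_sum:
  assumes "x \<le> y" "y \<le> n"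
  shows "(\<Sum>b\<in>{x..<y}. q ^ b * (qsum q (Suc b) (Suc n) - qsum q x (Suc b))) =
         (q - 1) * qsum2 q x y + q * (qsum q x y * qsum q y n)"
  using assms
proof (induction y rule: dec_induct)
  case (step y)
  have "qsum q y n = q ^ y + qsum q (Suc y) n"
    using step by (intro qsum_rec) auto
  with step show ?case
    by (simp add: qsum2_Suc qsum_Suc qsum_shift algebra_simps)
qed simp

section \<open>Inequalities between triple sums of powers of q\<close>

lemma triple_sum_ge_step:
  fixes u v h q :: real
  assumes "q \<ge> 1" "(u + v)\<^sup>2 \<le> 2 * h" "0 \<le> u" "0 \<le> v"
  shows "(1 + q) * (u * v) \<le> q * h"
proof -
  have "(1 + q) * (u * v) \<le> q * (2 * (u * v))"
    using assms mult_right_mono[of 1 q "u * v"] by (simp add: algebra_simps)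
  also have "\<dots> \<le> q * h"
  proof (intro mult_left_mono)
    have "0 \<le> (u - v)\<^sup>2" by simp
    with assms(2) show "2 * (u * v) \<le> h"
      by (simp add: power2_eq_square algebra_simps)
  qed (use assms in auto)
  finally show ?thesis .
qed

text \<open>Let u and v be the sums over x..y-1 and y..t. Passing from \<open>t\<close> to
  \<open>Suc t\<close> raises the left side by q^t (1 + q) u v and the right side by q^(t+1) h2,
  with h2 taken over x..t. Since u + v is the sum of all variables of this h2,
  \<open>triple_sum_ge_step\<close> compares the increments.\<close>

lemma triple_sum_ge_aux:
  assumes "q \<ge> 1" "x \<le> y" "y \<le> t"
  shows "qsum q x y * (qsum q y (Suc t) * qsum q y t) \<le>
    (\<Sum>j\<in>{y..<t}. q ^ j * (qsum q (Suc j) (Suc t) * qsum q x (Suc j))) +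
    qsum2 q x y * qsum q y (Suc t)"
  using assms(3)
proof (induction t rule: dec_induct)
  case base
  show ?case using assms qsum2_nonneg[of q x y] qsum_nonneg[of q y "Suc y"] by simp
next
  case (step t)
  let ?u = "qsum q x y" and ?v = "qsum q y (Suc t)"
  have v: "qsum q y (Suc (Suc t)) = ?v + q * q ^ t" "qsum q y t = ?v - q ^ t"
    using step by (simp_all add: qsum_Suc)
  have "(\<Sum>j\<in>{y..<t}. q ^ j * (qsum q (Suc j) (Suc (Suc t)) * qsum q x (Suc j))) =
        (\<Sum>j\<in>{y..<t}. q ^ j * (qsum q (Suc j) (Suc t) * qsum q x (Suc j))) +
        q * q ^ t * (\<Sum>j\<in>{y..<t}. q ^ j * qsum q x (Suc j))"
    unfolding sum_distrib_left sum.distrib[symmetric]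
    by (intro sum.cong refl) (simp add: qsum_Suc algebra_simps)
  moreover have "(\<Sum>j\<in>{y..<t}. q ^ j * qsum q x (Suc j)) + q ^ t * qsum q x (Suc t) =
      qsum2 q x (Suc t) - qsum2 q x y"
  proof -
    have "qsum2 q x (Suc t) = qsum2 q x y + (\<Sum>j\<in>{y..<Suc t}. q ^ j * qsum q x (Suc j))"
      unfolding qsum2_def using step assms by (intro sum.atLeastLessThan_concat[symmetric]) auto
    then show ?thesis using step by simp
  qed
  moreover have "qsum q (Suc t) (Suc (Suc t)) = q * q ^ t"
    by (simp add: qsum_Suc)
  ultimately have R: "(\<Sum>j\<in>{y..<Suc t}. q ^ j * (qsum q (Suc j) (Suc (Suc t)) * qsum q x (Suc j))) =
      (\<Sum>j\<in>{y..<t}. q ^ j * (qsum q (Suc j) (Suc t) * qsum q x (Suc j))) +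
      q * q ^ t * (qsum2 q x (Suc t) - qsum2 q x y)"
    using step by (simp add: algebra_simps flip: distrib_left)
  have "qsum q x (Suc t) = ?u + ?v"
    using step assms by (intro qsum_split) auto
  then have "(?u + ?v)\<^sup>2 \<le> 2 * qsum2 q x (Suc t)"
    using qsum2_ge[of q x "Suc t"] step assms by auto
  then have "(1 + q) * (?u * ?v) \<le> q * qsum2 q x (Suc t)"
    using assms by (intro triple_sum_ge_step) (auto intro: qsum_nonneg)
  then have "q ^ t * ((1 + q) * (?u * ?v)) \<le> q ^ t * (q * qsum2 q x (Suc t))"
    using assms by (intro mult_left_mono) auto
  with step.IH show ?case
    unfolding R v by (simp add: algebra_simps)
qed

text \<open>Makes the coefficient \<open>K\<close> in \<open>start_weight_double_gap\<close>
  nonnegative. Cut at \<open>Suc c\<close>: the terms with j > c appear in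
  \<open>triple_sum_ge_aux\<close> as they are, and those with j \<le> c dominate its h2
  term.\<close>

lemma triple_sum_ge:
  assumes "q \<ge> 1" "x \<le> c" "c < m"
  shows "qsum q (Suc c) (Suc m) * (qsum q (Suc c) (Suc (Suc m)) * qsum q x (Suc c)) \<le>
    (\<Sum>j\<in>{x..<Suc m}. q ^ j * (qsum q (Suc j) (Suc (Suc m)) * qsum q x (Suc j)))"
proof -
  have "qsum q x (Suc c) * (qsum q (Suc c) (Suc (Suc m)) * qsum q (Suc c) (Suc m)) \<le>
    (\<Sum>j\<in>{Suc c..<Suc m}. q ^ j * (qsum q (Suc j) (Suc (Suc m)) * qsum q x (Suc j))) +
    qsum2 q x (Suc c) * qsum q (Suc c) (Suc (Suc m))"
    using assms by (intro triple_sum_ge_aux) auto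
  also have "qsum2 q x (Suc c) * qsum q (Suc c) (Suc (Suc m)) \<le>
     (\<Sum>j\<in>{x..<Suc c}. q ^ j * (qsum q (Suc j) (Suc (Suc m)) * qsum q x (Suc j)))"
    unfolding qsum2_def sum_distrib_right
  proof (intro sum_mono)
    fix j assume "j \<in> {x..<Suc c}"
    then have "qsum q (Suc c) (Suc (Suc m)) \<le> qsum q (Suc j) (Suc (Suc m))"
      using assms by (intro qsum_mono) auto
    then have "q ^ j * qsum q x (Suc j) * qsum q (Suc c) (Suc (Suc m)) \<le>
       q ^ j * qsum q x (Suc j) * qsum q (Suc j) (Suc (Suc m))"
      using assms by (intro mult_left_mono mult_nonneg_nonneg qsum_nonneg) auto
    then show "q ^ j * qsum q x (Suc j) * qsum q (Suc c) (Suc (Suc m)) \<le>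
      q ^ j * (qsum q (Suc j) (Suc (Suc m)) * qsum q x (Suc j))"
      by (simp add: algebra_simps)
  qed
  also have "(\<Sum>j\<in>{Suc c..<Suc m}. q ^ j * (qsum q (Suc j) (Suc (Suc m)) * qsum q x (Suc j))) +
     (\<Sum>j\<in>{x..<Suc c}. q ^ j * (qsum q (Suc j) (Suc (Suc m)) * qsum q x (Suc j))) =
     (\<Sum>j\<in>{x..<Suc m}. q ^ j * (qsum q (Suc j) (Suc (Suc m)) * qsum q x (Suc j)))"
    using assms by (subst add.commute, intro sum.atLeastLessThan_concat) auto
  finally show ?thesis
    by (simp add: algebra_simps)
qed

text \<open>Downward induction on \<open>y\<close>: the new term on the left must be covered by the
  new term on the right together with q^y times the old sum of the \<open>s j\<close>. In
  \<open>start_weight_double_gap\<close> this pays for the negative terms of the lower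
  level.\<close>

lemma tail_sum_ge:
  assumes "q \<ge> 1" "x \<le> y" "y \<le> m"
  defines "s \<equiv> \<lambda>j. q ^ j * (qsum q (Suc j) (Suc (Suc m)) * qsum q x (Suc j))"
  shows "(\<Sum>c\<in>{y..<m}. s c * qsum q (Suc c) (Suc m)) \<le> qsum q y m * (\<Sum>j\<in>{y..<Suc m}. s j)"
  using assms(3,2)
proof (induction y rule: inc_induct)
  case (step y)
  let ?P = "qsum q (Suc y) (Suc (Suc m))" and ?M = "qsum q (Suc y) (Suc m)"
  define Y where "Y = q ^ y * qsum q x (Suc y)"
  have Y: "0 \<le> Y"
    using assms by (simp add: Y_def qsum_nonneg)
  \<comment> \<open>\<open>?P\<close> equals \<open>?M\<close> plus q^(m+1), so
    \<open>?P * ?M\<close> splits in two. The part with q^(m+1) is bounded here, since every inner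
    tail contains that power. The square of \<open>?M\<close> is bounded next, by moving a factor q
    from \<open>?P\<close> to \<open>qsum q y m\<close>.\<close>
  have "q ^ Suc m * ?M \<le> (\<Sum>j\<in>{Suc y..<Suc m}. q ^ j * qsum q (Suc j) (Suc (Suc m)))"
    unfolding qsum_def[of q "Suc y"] sum_distrib_left
    by (intro sum_mono) (use assms in \<open>auto simp: mult.commute qsum_Suc qsum_nonneg intro!: mult_left_mono\<close>)
  moreover have "?P * qsum q y m \<ge> ?M * ?M"
  proof -
    have "?P * qsum q y m = qsum q y (Suc m) * ?M"
      by (simp add: qsum_shift)
    also have "\<dots> \<ge> ?M * ?M"
      using assms by (intro mult_right_mono qsum_mono qsum_nonneg) auto
    finally show ?thesis .
  qed
  moreover have "?P = ?M + q ^ Suc m"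
    using step by (intro qsum_Suc) auto
  ultimately have "?P * ?M \<le> ?P * qsum q y m +
      (\<Sum>j\<in>{Suc y..<Suc m}. q ^ j * qsum q (Suc j) (Suc (Suc m)))"
    by (simp add: algebra_simps)
  then have "Y * (?P * ?M) \<le> Y * (?P * qsum q y m +
      (\<Sum>j\<in>{Suc y..<Suc m}. q ^ j * qsum q (Suc j) (Suc (Suc m))))"
    using Y by (intro mult_left_mono)
  also have "\<dots> = s y * qsum q y m +
      (\<Sum>j\<in>{Suc y..<Suc m}. q ^ y * (q ^ j * (qsum q (Suc j) (Suc (Suc m)) * qsum q x (Suc y))))"
    by (simp add: s_def Y_def algebra_simps sum_distrib_left)
  also have "\<dots> \<le> s y * qsum q y m + (\<Sum>j\<in>{Suc y..<Suc m}. q ^ y * s j)"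
    unfolding s_def using assms(1)
    by (intro add_left_mono sum_mono mult_left_mono qsum_mono qsum_nonneg) auto
  also have "\<dots> = s y * qsum q y m + q ^ y * (\<Sum>j\<in>{Suc y..<Suc m}. s j)"
    by (simp only: sum_distrib_left)
  also have "Y * (?P * ?M) = s y * ?M"
    by (simp add: s_def Y_def)
  finally have "s y * ?M \<le> s y * qsum q y m + q ^ y * (\<Sum>j\<in>{Suc y..<Suc m}. s j)" .
  moreover have "(\<Sum>c\<in>{Suc y..<m}. s c * qsum q (Suc c) (Suc m)) \<le>
      qsum q (Suc y) m * (\<Sum>j\<in>{Suc y..<Suc m}. s j)"
    using step by auto
  moreover have "qsum q y m = q ^ y + qsum q (Suc y) m"
    using step by (intro qsum_rec) auto
  moreover have "(\<Sum>j\<in>{y..<Suc m}. s j) = s y + (\<Sum>j\<in>{Suc y..<Suc m}. s j)"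
     "(\<Sum>c\<in>{y..<m}. s c * qsum q (Suc c) (Suc m)) =
       s y * ?M + (\<Sum>c\<in>{Suc y..<m}. s c * qsum q (Suc c) (Suc m))"
    using step by (intro sum.atLeast_Suc_lessThan; simp)+
  ultimately show ?case
    by (simp add: algebra_simps)
qed simp


subsection \<open>The recursion for 132-avoiders by first letter\<close>

text \<open>In the correction, \<open>c\<close> is the rank of the third letter after the first has
  been deleted. Letters above the first have moved down by one, so c \<ge> x means that the third
  letter exceeds the first. The second letter has a rank from c + 1 to n, which produces the
  \<open>qsum\<close>. Length 0 gets the value 0, as there is no first letter.\<close>

fun start_weight :: "real \<Rightarrow> nat \<Rightarrow> nat \<Rightarrow> real" where
  "start_weight q 0 x = 0"
| "start_weight q (Suc 0) x = q ^ x"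
| "start_weight q (Suc (Suc n)) x = q ^ x * ((\<Sum>c<Suc n. start_weight q (Suc n) c) -
     (\<Sum>c\<in>{x..<n}. start_weight q n c * qsum q (Suc c) (Suc n)))"

declare start_weight.simps(3) [simp del]

lemma sum_swap_triangle:
  fixes f :: "nat \<Rightarrow> nat \<Rightarrow> real"
  shows "(\<Sum>p\<in>{x..<y}. \<Sum>c\<in>{x..<p}. f p c) = (\<Sum>c\<in>{x..<y}. \<Sum>p\<in>{Suc c..<y}. f p c)"
proof -
  have "(\<Sum>p\<in>{x..<y}. \<Sum>c\<in>{x..<p}. f p c) = (\<Sum>p\<in>{x..<y}. \<Sum>c | c \<in> {x..<y} \<and> c < p. f p c)"
    by (intro sum.cong refl) auto
  also have "\<dots> = (\<Sum>c\<in>{x..<y}. \<Sum>p | p \<in> {x..<y} \<and> c < p. f p c)"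
    by (rule sum.swap_restrict) auto
  also have "\<dots> = (\<Sum>c\<in>{x..<y}. \<Sum>p\<in>{Suc c..<y}. f p c)"
    by (intro sum.cong refl) auto
  finally show ?thesis .
qed

text \<open>Turns the correction term of \<open>start_weight\<close> into a sum over words that
  begin with a descent p > c, to be compared with \<open>start_weight\<close> letter by
  letter.\<close>

lemma sum_swap_triangle_qsum:
  fixes f :: "nat \<Rightarrow> real"
  shows "(\<Sum>p\<in>{x..<Suc n}. q ^ p * (\<Sum>c\<in>{x..<p}. f c)) = (\<Sum>c\<in>{x..<n}. f c * qsum q (Suc c) (Suc n))"
proof -
  have "(\<Sum>p\<in>{x..<Suc n}. q ^ p * (\<Sum>c\<in>{x..<p}. f c)) =
        (\<Sum>c\<in>{x..<Suc n}. \<Sum>p\<in>{Suc c..<Suc n}. q ^ p * f c)"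
    unfolding sum_distrib_left by (rule sum_swap_triangle)
  also have "\<dots> = (\<Sum>c\<in>{x..<Suc n}. f c * qsum q (Suc c) (Suc n))"
    by (simp only: qsum_def sum_distrib_left mult.commute)
  also have "\<dots> = (\<Sum>c\<in>{x..<n}. f c * qsum q (Suc c) (Suc n))"
    by (intro sum.mono_neutral_right) auto
  finally show ?thesis .
qed

lemma sum_lessThan_split:
  fixes f :: "nat \<Rightarrow> real"
  assumes "x \<le> n"
  shows "(\<Sum>c<n. f c) = (\<Sum>c<x. f c) + (\<Sum>c\<in>{x..<n}. f c)"
  using assms sum.atLeastLessThan_concat[of 0 x n f] by (simp add: atLeast0LessThan)

text \<open>A letter followed by a smaller one cannot start an occurrence of 132.\<close>

lemma start_weight_nonneg_and_ge:
  assumes "0 \<le> q"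
  shows "(\<forall>x<n. 0 \<le> start_weight q n x) \<and>
         (\<forall>x\<le>n. q ^ x * (\<Sum>c<x. start_weight q n c) \<le> start_weight q (Suc n) x)"
proof (induction n)
  case 0
  show ?case by simp
next
  case (Suc m)
  have m_nonneg: "0 \<le> start_weight q m c" if "c < m" for c
    using Suc that by auto
  have m_ge: "q ^ p * (\<Sum>c<p. start_weight q m c) \<le> start_weight q (Suc m) p" if "p \<le> m" for p
    using Suc that by auto
  have nonneg: "0 \<le> start_weight q (Suc m) x" if "x < Suc m" for x
  proof -
    have "0 \<le> q ^ x * (\<Sum>c<x. start_weight q m c)"
      using that assms m_nonneg by (intro mult_nonneg_nonneg sum_nonneg) auto
    also have "\<dots> \<le> start_weight q (Suc m) x"
      using m_ge that by auto
    finally show ?thesis .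
  qed
  have "q ^ x * (\<Sum>c<x. start_weight q (Suc m) c) \<le> start_weight q (Suc (Suc m)) x"
    if x: "x \<le> Suc m" for x
  proof -
    \<comment> \<open>The correction weighs words beginning with a descent from \<open>p\<close>. By
      the induction hypothesis these weigh at most as much as all avoiders beginning with
      \<open>p\<close>, so subtracting leaves at least the letters below \<open>x\<close>.\<close>
    have "(\<Sum>c\<in>{x..<m}. start_weight q m c * qsum q (Suc c) (Suc m)) =
          (\<Sum>p\<in>{x..<Suc m}. q ^ p * (\<Sum>c\<in>{x..<p}. start_weight q m c))"
      by (rule sum_swap_triangle_qsum[symmetric])
    also have "\<dots> \<le> (\<Sum>p\<in>{x..<Suc m}. start_weight q (Suc m) p)"
    proof (intro sum_mono)
      fix p assume p: "p \<in> {x..<Suc m}"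
      have "(\<Sum>c\<in>{x..<p}. start_weight q m c) \<le> (\<Sum>c<p. start_weight q m c)"
        using p m_nonneg by (intro sum_mono2) auto
      then have "q ^ p * (\<Sum>c\<in>{x..<p}. start_weight q m c) \<le> q ^ p * (\<Sum>c<p. start_weight q m c)"
        using assms by (intro mult_left_mono) auto
      also have "\<dots> \<le> start_weight q (Suc m) p"
        using p m_ge by auto
      finally show "q ^ p * (\<Sum>c\<in>{x..<p}. start_weight q m c) \<le> start_weight q (Suc m) p" .
    qed
    finally have "(\<Sum>c<x. start_weight q (Suc m) c) \<le> (\<Sum>c<Suc m. start_weight q (Suc m) c) -
        (\<Sum>c\<in>{x..<m}. start_weight q m c * qsum q (Suc c) (Suc m))"
      unfolding sum_lessThan_split[OF x] by simp
    then show ?thesis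
      unfolding start_weight.simps(3) using assms by (intro mult_left_mono) auto
  qed
  with nonneg show ?case by auto
qed

lemma start_weight_nonneg: "0 \<le> q \<Longrightarrow> x < n \<Longrightarrow> 0 \<le> start_weight q n x"
  using start_weight_nonneg_and_ge by auto

lemma start_weight_ge:
  "0 \<le> q \<Longrightarrow> x \<le> n \<Longrightarrow> q ^ x * (\<Sum>c<x. start_weight q n c) \<le> start_weight q (Suc n) x"
  using start_weight_nonneg_and_ge by auto

section \<open>The subsolution property\<close>

lemma start_weight_sum_ge:
  assumes "0 \<le> q"
  shows "(\<Sum>c\<in>{x..<n}. start_weight q n c * qsum q (Suc c) (Suc n)) \<le> (\<Sum>c<Suc n. start_weight q (Suc n) c)"
proof -
  have "(\<Sum>c\<in>{x..<n}. start_weight q n c * qsum q (Suc c) (Suc n)) \<le>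
        (\<Sum>c\<in>{0..<n}. start_weight q n c * qsum q (Suc c) (Suc n))"
    using assms start_weight_nonneg by (intro sum_mono2) (auto intro!: mult_nonneg_nonneg qsum_nonneg)
  also have "\<dots> = (\<Sum>p\<in>{0..<Suc n}. q ^ p * (\<Sum>c\<in>{0..<p}. start_weight q n c))"
    by (rule sum_swap_triangle_qsum[symmetric])
  also have "\<dots> \<le> (\<Sum>p\<in>{0..<Suc n}. start_weight q (Suc n) p)"
    using assms start_weight_ge by (intro sum_mono) (auto simp: atLeast0LessThan)
  finally show ?thesis by (simp add: atLeast0LessThan)
qed

text \<open>One step of the recursion applied to a linear functional with test function
  \<open>f\<close>. After the order of summation is swapped, the constraints c \<le> d and c < y
  meet in \<open>min y (Suc d)\<close>.\<close>

lemma sum_start_weight_mult: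
  "(\<Sum>c\<in>{x..<y}. start_weight q (Suc (Suc n)) c * f c) =
   (\<Sum>c<Suc n. start_weight q (Suc n) c) * (\<Sum>c\<in>{x..<y}. q ^ c * f c) -
   (\<Sum>d\<in>{x..<n}. start_weight q n d * qsum q (Suc d) (Suc n) * (\<Sum>c\<in>{x..<min y (Suc d)}. q ^ c * f c))"
proof -
  have "(\<Sum>c\<in>{x..<y}. start_weight q (Suc (Suc n)) c * f c) =
     (\<Sum>c<Suc n. start_weight q (Suc n) c) * (\<Sum>c\<in>{x..<y}. q ^ c * f c) -
     (\<Sum>c\<in>{x..<y}. \<Sum>d\<in>{c..<n}. start_weight q n d * qsum q (Suc d) (Suc n) * (q ^ c * f c))"
    unfolding start_weight.simps(3) sum_distrib_left sum_subtractf[symmetric]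
    by (intro sum.cong refl) (simp add: algebra_simps sum_distrib_left sum_distrib_right)
  also have "(\<Sum>c\<in>{x..<y}. \<Sum>d\<in>{c..<n}. start_weight q n d * qsum q (Suc d) (Suc n) * (q ^ c * f c)) =
    (\<Sum>c\<in>{x..<y}. \<Sum>d | d \<in> {x..<n} \<and> c \<le> d. start_weight q n d * qsum q (Suc d) (Suc n) * (q ^ c * f c))"
    by (intro sum.cong refl) auto
  also have "\<dots> = (\<Sum>d\<in>{x..<n}. \<Sum>c | c \<in> {x..<y} \<and> c \<le> d. start_weight q n d * qsum q (Suc d) (Suc n) * (q ^ c * f c))"
    by (rule sum.swap_restrict) auto
  also have "\<dots> = (\<Sum>d\<in>{x..<n}. start_weight q n d * qsum q (Suc d) (Suc n) * (\<Sum>c\<in>{x..<min y (Suc d)}. q ^ c * f c))"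
    unfolding sum_distrib_left by (intro sum.cong refl) auto
  finally show ?thesis .
qed

text \<open>Unfolding the right side once leaves values of level m with nonnegative coefficients and
  negative terms of the level below. The descent bound \<open>start_weight_ge\<close> at level m
  pays for the latter, coefficient by coefficient.\<close>

lemma start_weight_double_gap:
  assumes "q \<ge> 1"
  defines "S \<equiv> \<lambda>m x c. qsum q (Suc c) (Suc (Suc m)) * qsum q x (Suc c)"
  shows "(\<Sum>d\<in>{x..<m}. start_weight q m d * qsum q (Suc d) (Suc m) * S m x d) \<le>
         (\<Sum>c\<in>{x..<Suc m}. start_weight q (Suc m) c * S m x c)"
proof (cases m)
  case 0
  then show ?thesis using assms
    by (cases x) (auto simp: S_def intro!: mult_nonneg_nonneg qsum_nonneg)
next
  case (Suc p)
  define s where "s = (\<lambda>c. q ^ c * S m x c)"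
  \<comment> \<open>\<open>K c\<close> is, for c \<ge> x, the coefficient of
    \<open>start_weight q m c\<close> in the unfolded right side minus the left side. Letters c < x
    occur on the right only, with nonnegative coefficients, and are dropped at the end.\<close>
  define K where "K = (\<lambda>c. (\<Sum>j\<in>{x..<Suc m}. s j) - qsum q (Suc c) (Suc m) * S m x c)"
  have q0: "0 \<le> q" using assms by simp
  have s_nonneg: "0 \<le> s j" for j
    using q0 by (auto simp: s_def S_def intro!: mult_nonneg_nonneg qsum_nonneg)
  have K_nonneg: "0 \<le> K c" if "c \<in> {x..<m}" for c
    using triple_sum_ge[OF assms(1), of x c m] that by (simp add: K_def s_def S_def)
  have eq: "(\<Sum>c\<in>{x..<Suc m}. start_weight q (Suc m) c * S m x c) =
     (\<Sum>c<m. start_weight q m c) * (\<Sum>c\<in>{x..<Suc m}. s c) -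
     (\<Sum>d\<in>{x..<p}. start_weight q p d * qsum q (Suc d) m * (\<Sum>c\<in>{x..<Suc d}. s c))"
    unfolding Suc sum_start_weight_mult s_def
    by (intro arg_cong2[where f = "(-)"] refl sum.cong arg_cong2[where f = "(*)"]) auto
  have "(\<Sum>d\<in>{x..<p}. start_weight q p d * qsum q (Suc d) m * (\<Sum>c\<in>{x..<Suc d}. s c)) \<le>
        (\<Sum>d\<in>{x..<p}. start_weight q p d * (\<Sum>c\<in>{Suc d..<m}. q ^ c * K c))"
  proof (intro sum_mono)
    fix d assume d: "d \<in> {x..<p}"
    have "(\<Sum>c\<in>{Suc d..<m}. q ^ c * K c) = qsum q (Suc d) m * (\<Sum>j\<in>{x..<Suc m}. s j) -
          (\<Sum>c\<in>{Suc d..<m}. s c * qsum q (Suc c) (Suc m))"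
      unfolding qsum_def[of q "Suc d"] sum_distrib_right sum_subtractf[symmetric]
      by (intro sum.cong refl) (simp add: K_def s_def algebra_simps)
    moreover have "(\<Sum>j\<in>{x..<Suc m}. s j) = (\<Sum>j\<in>{x..<Suc d}. s j) + (\<Sum>j\<in>{Suc d..<Suc m}. s j)"
      using d Suc by (intro sum.atLeastLessThan_concat[symmetric]) auto
    moreover have "(\<Sum>c\<in>{Suc d..<m}. s c * qsum q (Suc c) (Suc m)) \<le>
        qsum q (Suc d) m * (\<Sum>j\<in>{Suc d..<Suc m}. s j)"
      unfolding s_def S_def using d Suc assms by (intro tail_sum_ge) auto
    ultimately have "qsum q (Suc d) m * (\<Sum>c\<in>{x..<Suc d}. s c) \<le> (\<Sum>c\<in>{Suc d..<m}. q ^ c * K c)"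
      by (simp only: distrib_left)
    then show "start_weight q p d * qsum q (Suc d) m * (\<Sum>c\<in>{x..<Suc d}. s c) \<le>
       start_weight q p d * (\<Sum>c\<in>{Suc d..<m}. q ^ c * K c)"
      using d start_weight_nonneg[OF q0] by (simp only: mult.assoc) (intro mult_left_mono, auto)
  qed
  also have "\<dots> = (\<Sum>d\<in>{x..<m}. \<Sum>c\<in>{Suc d..<m}. start_weight q p d * (q ^ c * K c))"
    unfolding sum_distrib_left Suc by (intro sum.mono_neutral_left) auto
  also have "\<dots> = (\<Sum>c\<in>{x..<m}. \<Sum>d\<in>{x..<c}. start_weight q p d * (q ^ c * K c))"
    by (rule sum_swap_triangle[symmetric])
  also have "\<dots> \<le> (\<Sum>c\<in>{x..<m}. start_weight q m c * K c)"
  proof (intro sum_mono)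
    fix c assume c: "c \<in> {x..<m}"
    have "(\<Sum>d\<in>{x..<c}. start_weight q p d) \<le> (\<Sum>d<c. start_weight q p d)"
      using c Suc start_weight_nonneg[OF q0] by (intro sum_mono2) auto
    then have "q ^ c * (\<Sum>d\<in>{x..<c}. start_weight q p d) \<le> q ^ c * (\<Sum>d<c. start_weight q p d)"
      using q0 by (intro mult_left_mono) auto
    also have "\<dots> \<le> start_weight q m c"
      using c Suc start_weight_ge[OF q0, of c p] by auto
    finally have "q ^ c * (\<Sum>d\<in>{x..<c}. start_weight q p d) * K c \<le> start_weight q m c * K c"
      using K_nonneg c by (intro mult_right_mono) auto
    then show "(\<Sum>d\<in>{x..<c}. start_weight q p d * (q ^ c * K c)) \<le> start_weight q m c * K c"
      by (simp add: sum_distrib_left sum_distrib_right algebra_simps)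
  qed
  also have "\<dots> = (\<Sum>c\<in>{x..<m}. start_weight q m c) * (\<Sum>j\<in>{x..<Suc m}. s j) -
      (\<Sum>d\<in>{x..<m}. start_weight q m d * qsum q (Suc d) (Suc m) * S m x d)"
    unfolding sum_distrib_right[of _ "{x..<m}"] sum_subtractf[symmetric]
    by (intro sum.cong refl) (simp only: K_def right_diff_distrib mult.assoc)
  also have "(\<Sum>c\<in>{x..<m}. start_weight q m c) * (\<Sum>j\<in>{x..<Suc m}. s j) \<le>
      (\<Sum>c<m. start_weight q m c) * (\<Sum>j\<in>{x..<Suc m}. s j)"
    using s_nonneg start_weight_nonneg[OF q0]
    by (intro mult_right_mono sum_mono2 sum_nonneg) auto
  finally show ?thesis
    unfolding eq by linarith
qed

text \<open>The expression is the right side minus the left side of \<open>start_weight_le\<close>,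
  divided by q^x.\<close>

lemma start_weight_gap:
  assumes "q \<ge> 1"
  shows "0 \<le> (\<Sum>c\<in>{x..<Suc n}. start_weight q (Suc n) c * (qsum q (Suc c) (Suc (Suc n)) - qsum q x (Suc c))) +
         (\<Sum>c\<in>{x..<n}. start_weight q n c * qsum q (Suc c) (Suc n) * qsum q x (Suc c))"
proof (cases n)
  case 0
  then show ?thesis using assms by (cases x) (auto simp: qsum_def)
next
  case (Suc m)
  define R where "R = (\<lambda>y. \<Sum>b\<in>{x..<y}. q ^ b * (qsum q (Suc b) (Suc (Suc n)) - qsum q x (Suc b)))"
  define S where "S = (\<lambda>c. qsum q (Suc c) (Suc (Suc m)) * qsum q x (Suc c))"
  define T where "T = (\<Sum>c<n. start_weight q n c)"
  have q0: "0 \<le> q" using assms by simp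
  show ?thesis
  proof (cases "x \<le> n")
    case False
    then show ?thesis by simp
  next
    case True
    have R: "R y = (q - 1) * qsum2 q x y + q * (qsum q x y * qsum q y (Suc n))"
      if "x \<le> y" "y \<le> Suc n" for y
      unfolding R_def by (rule weighted_gap_sum[OF that])
    have "(\<Sum>c\<in>{x..<Suc n}. start_weight q (Suc n) c * (qsum q (Suc c) (Suc (Suc n)) - qsum q x (Suc c))) =
      T * R (Suc n) - (\<Sum>d\<in>{x..<m}. start_weight q m d * qsum q (Suc d) n * R (Suc d))"
      unfolding Suc sum_start_weight_mult R_def T_def
      by (intro arg_cong2[where f = "(-)"] refl sum.cong arg_cong2[where f = "(*)"]) auto
    \<comment> \<open>At the upper end the product term of \<open>weighted_gap_sum\<close> has an
      empty factor, so \<open>T\<close> keeps only a multiple of q - 1.\<close>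
    also have "\<dots> = T * ((q - 1) * qsum2 q x (Suc n)) - (\<Sum>d\<in>{x..<m}. start_weight q m d * qsum q (Suc d) n *
        ((q - 1) * qsum2 q x (Suc d) + q * S d))"
      using True R[of "Suc n"] R[of "Suc d" for d]
      by (intro arg_cong2[where f = "(-)"] sum.cong arg_cong2[where f = "(*)"])
        (auto simp: S_def Suc mult.commute)
    also have "\<dots> \<ge> - (\<Sum>d\<in>{x..<m}. start_weight q m d * qsum q (Suc d) n * S d)"
    proof -
      \<comment> \<open>Writing q S = S + (q - 1) S, all terms with the nonnegative factor q - 1 are
        absorbed by the \<open>T\<close> term. The remaining \<open>S\<close> terms are left to
        \<open>start_weight_double_gap\<close>.\<close>
      have "(\<Sum>d\<in>{x..<m}. start_weight q m d * qsum q (Suc d) n * ((q - 1) * qsum2 q x (Suc d) + q * S d)) -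
          (\<Sum>d\<in>{x..<m}. start_weight q m d * qsum q (Suc d) n * S d) =
          (\<Sum>d\<in>{x..<m}. start_weight q m d * qsum q (Suc d) n * ((q - 1) * (qsum2 q x (Suc d) + S d)))"
        unfolding sum_subtractf[symmetric] by (intro sum.cong refl) (simp add: algebra_simps)
      also have "\<dots> \<le> (\<Sum>d\<in>{x..<m}. start_weight q m d * qsum q (Suc d) n * ((q - 1) * qsum2 q x (Suc n)))"
      proof (intro sum_mono mult_left_mono)
        fix d assume d: "d \<in> {x..<m}"
        then show "qsum2 q x (Suc d) + S d \<le> qsum2 q x (Suc n)"
          using qsum2_add_ge[OF q0, of x "Suc d" "Suc n"] by (simp add: S_def Suc mult.commute)
        show "0 \<le> start_weight q m d * qsum q (Suc d) n"
          using d q0 by (intro mult_nonneg_nonneg start_weight_nonneg qsum_nonneg) auto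
      qed (use assms in simp)
      also have "\<dots> \<le> T * ((q - 1) * qsum2 q x (Suc n))"
        unfolding sum_distrib_right[symmetric] T_def Suc
        using assms q0 by (intro mult_right_mono start_weight_sum_ge mult_nonneg_nonneg qsum2_nonneg) auto
      finally show ?thesis by linarith
    qed
    finally have "- (\<Sum>d\<in>{x..<m}. start_weight q m d * qsum q (Suc d) n * S d) \<le>
      (\<Sum>c\<in>{x..<Suc n}. start_weight q (Suc n) c * (qsum q (Suc c) (Suc (Suc n)) - qsum q x (Suc c)))" .
    moreover have "(\<Sum>d\<in>{x..<m}. start_weight q m d * qsum q (Suc d) n * S d) \<le>
      (\<Sum>c\<in>{x..<n}. start_weight q n c * qsum q (Suc c) (Suc n) * qsum q x (Suc c))"
      using start_weight_double_gap[OF assms, of m x] by (simp only: S_def Suc mult.assoc)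
    ultimately show ?thesis by linarith
  qed
qed

text \<open>The two sums mirror the second letter \<open>a\<close> of a 123-avoider starting with
  \<open>x\<close>: either below \<open>x\<close>, or above it and followed by some b < a. In the
  latter case \<open>a\<close> counts with its rank after the deletion of \<open>x\<close>.\<close>

lemma start_weight_le:
  assumes "q \<ge> 1" "x \<le> Suc (Suc n)"
  shows "start_weight q (Suc (Suc (Suc n))) x \<le>
    q ^ x * ((\<Sum>a<x. start_weight q (Suc (Suc n)) a) +
             (\<Sum>a\<in>{x..<Suc (Suc n)}. q ^ a * (\<Sum>b<a. start_weight q (Suc n) b)))"
proof -
  let ?G = "start_weight q" and ?n = "Suc n"
  have q0: "0 \<le> q" using assms by simp
  have "(\<Sum>a\<in>{x..<Suc ?n}. ?G (Suc ?n) a) = (\<Sum>a\<in>{x..<Suc ?n}. ?G (Suc ?n) a * 1)"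
    by simp
  also have "\<dots> = (\<Sum>c<?n. ?G ?n c) * qsum q x (Suc ?n) -
      (\<Sum>d\<in>{x..<n}. ?G n d * qsum q (Suc d) ?n * qsum q x (Suc d))"
    unfolding sum_start_weight_mult
    by (intro arg_cong2[where f = "(-)"] refl sum.cong arg_cong2[where f = "(*)"]) (auto simp: qsum_def)
  also have "\<dots> \<le> (\<Sum>c<?n. ?G ?n c) * qsum q x (Suc ?n) +
      (\<Sum>c\<in>{x..<?n}. ?G ?n c * (qsum q (Suc c) (Suc ?n) - qsum q x (Suc c)))"
    using start_weight_gap[OF assms(1), of n x] by linarith
  finally have le: "(\<Sum>a\<in>{x..<Suc ?n}. ?G (Suc ?n) a) \<le> (\<Sum>c<?n. ?G ?n c) * qsum q x (Suc ?n) +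
      (\<Sum>c\<in>{x..<?n}. ?G ?n c * (qsum q (Suc c) (Suc ?n) - qsum q x (Suc c)))" .
  \<comment> \<open>\<open>X\<close> occurs twice: as the correction in the recursion on the left,
    and as the part b \<ge> x of the double sum on the right.\<close>
  define X where "X = (\<Sum>c\<in>{x..<?n}. ?G ?n c * qsum q (Suc c) (Suc ?n))"
  have split: "(\<Sum>c<?n. ?G ?n c) * qsum q x (Suc ?n) =
      qsum q x (Suc ?n) * (\<Sum>c<x. ?G ?n c) +
      (X + (\<Sum>c\<in>{x..<?n}. ?G ?n c * qsum q x (Suc c)))"
  proof (cases "x \<le> ?n")
    case True
    have "X + (\<Sum>c\<in>{x..<?n}. ?G ?n c * qsum q x (Suc c)) = qsum q x (Suc ?n) * (\<Sum>c\<in>{x..<?n}. ?G ?n c)"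
      unfolding X_def sum.distrib[symmetric] sum_distrib_left
    proof (intro sum.cong refl)
      fix c assume "c \<in> {x..<?n}"
      then have "qsum q x (Suc ?n) = qsum q x (Suc c) + qsum q (Suc c) (Suc ?n)"
        by (intro qsum_split) auto
      then show "?G ?n c * qsum q (Suc c) (Suc ?n) + ?G ?n c * qsum q x (Suc c) = qsum q x (Suc ?n) * ?G ?n c"
        by (simp add: algebra_simps)
    qed
    moreover have "(\<Sum>c<?n. ?G ?n c) * qsum q x (Suc ?n) =
        qsum q x (Suc ?n) * (\<Sum>c<x. ?G ?n c) + qsum q x (Suc ?n) * (\<Sum>c\<in>{x..<?n}. ?G ?n c)"
      unfolding sum_lessThan_split[OF True] by (simp only: distrib_left mult.commute)
    ultimately show ?thesis by linarith
  qed (simp add: X_def)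
  have "(\<Sum>a\<in>{x..<Suc ?n}. q ^ a * (\<Sum>b<a. ?G ?n b)) =
      (\<Sum>a\<in>{x..<Suc ?n}. q ^ a * (\<Sum>b<x. ?G ?n b)) + (\<Sum>a\<in>{x..<Suc ?n}. q ^ a * (\<Sum>b\<in>{x..<a}. ?G ?n b))"
    unfolding sum.distrib[symmetric]
  proof (intro sum.cong refl)
    fix a assume "a \<in> {x..<Suc ?n}"
    then have "x \<le> a" by simp
    then show "q ^ a * (\<Sum>b<a. ?G ?n b) = q ^ a * (\<Sum>b<x. ?G ?n b) + q ^ a * (\<Sum>b\<in>{x..<a}. ?G ?n b)"
      by (simp only: sum_lessThan_split[of x a] distrib_left)
  qed
  also have "(\<Sum>a\<in>{x..<Suc ?n}. q ^ a * (\<Sum>b\<in>{x..<a}. ?G ?n b)) = X"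
    unfolding X_def by (rule sum_swap_triangle_qsum)
  also have "(\<Sum>a\<in>{x..<Suc ?n}. q ^ a * (\<Sum>b<x. ?G ?n b)) = qsum q x (Suc ?n) * (\<Sum>b<x. ?G ?n b)"
    by (simp only: qsum_def sum_distrib_right)
  finally have rhs: "(\<Sum>a\<in>{x..<Suc ?n}. q ^ a * (\<Sum>b<a. ?G ?n b)) =
      qsum q x (Suc ?n) * (\<Sum>b<x. ?G ?n b) + X" .
  have "(\<Sum>c\<in>{x..<?n}. ?G ?n c * (qsum q (Suc c) (Suc ?n) - qsum q x (Suc c))) =
      X - (\<Sum>c\<in>{x..<?n}. ?G ?n c * qsum q x (Suc c))"
    by (simp only: X_def right_diff_distrib sum_subtractf)
  with le split rhs have "(\<Sum>c<Suc ?n. ?G (Suc ?n) c) - X \<le>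
     (\<Sum>a<x. ?G (Suc ?n) a) + (\<Sum>a\<in>{x..<Suc ?n}. q ^ a * (\<Sum>b<a. ?G ?n b))"
    unfolding sum_lessThan_split[OF assms(2)] by linarith
  then show ?thesis
    unfolding start_weight.simps(3)[of q ?n] X_def[symmetric] using q0 by (intro mult_left_mono) auto
qed

text \<open>Prepending the largest letter preserves avoidance. Positivity is required later for the
  existence of the growth rates.\<close>

lemma start_weight_total_pos:
  assumes "0 < q"
  shows "0 < (\<Sum>c<Suc n. start_weight q (Suc n) c)"
proof (induction n)
  case (Suc n)
  have "0 < q ^ Suc n * (\<Sum>c<Suc n. start_weight q (Suc n) c)"
    using Suc assms by simp
  also have "\<dots> \<le> start_weight q (Suc (Suc n)) (Suc n)"
    using assms by (intro start_weight_ge) auto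
  also have "\<dots> \<le> (\<Sum>c<Suc (Suc n). start_weight q (Suc (Suc n)) c)"
    using assms by (intro member_le_sum) (auto intro: start_weight_nonneg)
  finally show ?case .
qed simp

subsection \<open>Avoiders with prescribed first letter\<close>

lemma sum_permutations_of_set_Cons:
  fixes f :: "'a list \<Rightarrow> real"
  assumes "finite A" "A \<noteq> {}"
  shows "(\<Sum>\<pi>\<in>permutations_of_set A. f \<pi>) = (\<Sum>x\<in>A. \<Sum>w\<in>permutations_of_set (A - {x}). f (x # w))"
proof -
  have "(\<Sum>\<pi>\<in>permutations_of_set A. f \<pi>) =
        (\<Sum>x\<in>A. \<Sum>\<pi>\<in>(#) x ` permutations_of_set (A - {x}). f \<pi>)"
    unfolding permutations_of_set_nonempty[OF assms(2)]
    using assms by (intro sum.UNION_disjoint) auto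
  also have "\<dots> = (\<Sum>x\<in>A. \<Sum>w\<in>permutations_of_set (A - {x}). f (x # w))"
    by (rule sum.cong[OF refl]) (subst sum.reindex, auto)
  finally show ?thesis .
qed

section \<open>Ranks of letters in a finite set\<close>

definition rank :: "nat set \<Rightarrow> nat \<Rightarrow> nat" where
  "rank A x = card {y \<in> A. y < x}"

lemma rank_remove: "a \<notin> A \<or> c \<le> a \<Longrightarrow> rank (A - {a}) c = rank A c"
  unfolding rank_def by (rule arg_cong[where f = card]) auto

lemma rank_less_iff:
  assumes "finite A" "a \<in> A" "b \<in> A"
  shows "rank A a < rank A b \<longleftrightarrow> a < b"
proof -
  have *: "rank A a < rank A b" if "a < b" "a \<in> A" for a b
    unfolding rank_def using that assms(1) by (intro psubset_card_mono) auto
  show ?thesis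
    using *[of a b] *[of b a] assms by (cases a b rule: linorder_cases) auto
qed

text \<open>Deleting \<open>x\<close> keeps the ranks of smaller letters and lowers those of larger
  ones by one, so the old rank of \<open>x\<close> still separates the two kinds.\<close>

lemma rank_remove_less_iff:
  assumes "finite A" "x \<in> A" "c \<in> A - {x}"
  shows "rank (A - {x}) c < rank A x \<longleftrightarrow> c < x"
proof
  assume "c < x"
  then show "rank (A - {x}) c < rank A x"
    unfolding rank_def using assms by (intro psubset_card_mono) auto
next
  assume *: "rank (A - {x}) c < rank A x"
  have "rank A x \<le> rank (A - {x}) c" if "x < c"
    unfolding rank_def using assms that by (intro card_mono) auto
  with * assms show "c < x"
    by (cases x c rule: linorder_cases) auto
qed

lemma rank_bij:
  assumes "finite A"
  shows "bij_betw (rank A) A {..<card A}"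
proof -
  have inj: "inj_on (rank A) A"
    using assms by (auto intro!: linorder_inj_onI' simp: rank_less_iff less_imp_neq)
  have "rank A x < card A" if "x \<in> A" for x
    unfolding rank_def using assms that by (intro psubset_card_mono) auto
  then have "rank A ` A \<subseteq> {..<card A}" by auto
  moreover have "card (rank A ` A) = card {..<card A}"
    using inj by (simp add: card_image)
  ultimately have "rank A ` A = {..<card A}"
    by (intro card_subset_eq) auto
  with inj show ?thesis by (simp add: bij_betw_def)
qed

lemma rank_less_card: "finite A \<Longrightarrow> x \<in> A \<Longrightarrow> rank A x < card A"
  using rank_bij bij_betwE by blast

lemma sum_rank: "finite A \<Longrightarrow> (\<Sum>x\<in>A. f (rank A x)) = (\<Sum>i<card A. f i)"
  by (rule sum.reindex_bij_betw[OF rank_bij])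

section \<open>Inversions and occurrences when a letter is prepended\<close>

lemma inv_count_Nil [simp]: "inv_count [] = 0"
  by (simp add: inv_count_def)

lemma inv_count_Cons: "inv_count (x # w) = length (filter (\<lambda>y. y < x) w) + inv_count w"
proof -
  have "{(i, j). i < j \<and> j < length (x # w) \<and> (x # w) ! i > (x # w) ! j} =
     (\<lambda>j. (0, Suc j)) ` {j. j < length w \<and> w ! j < x} \<union>
     (\<lambda>(i, j). (Suc i, Suc j)) ` {(i, j). i < j \<and> j < length w \<and> w ! i > w ! j}" (is "?L = ?A \<union> ?B")
  proof (intro set_eqI iffI)
    fix p assume "p \<in> ?L"
    then obtain i j where "p = (i, j)" "i < j" "j < Suc (length w)" "(x # w) ! i > (x # w) ! j"
      by auto
    then show "p \<in> ?A \<union> ?B"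
      by (cases i; cases j) (auto simp: image_iff)
  qed auto
  moreover have "finite {(i, j). i < j \<and> j < length w \<and> w ! i > w ! j}"
    by (rule finite_subset[of _ "{..<length w} \<times> {..<length w}"]) auto
  ultimately have "inv_count (x # w) = card ?A + card ?B"
    unfolding inv_count_def by (simp only:) (intro card_Un_disjoint, auto)
  also have "card ?A = length (filter (\<lambda>y. y < x) w)"
    by (subst card_image) (auto simp: inj_on_def length_filter_conv_card)
  also have "card ?B = inv_count w"
    unfolding inv_count_def by (subst card_image) (auto simp: inj_on_def)
  finally show ?thesis .
qed

lemma inv_count_Cons_permutation:
  assumes "w \<in> permutations_of_set (A - {x})"
  shows "inv_count (x # w) = rank A x + inv_count w"
proof -
  have "length (filter (\<lambda>y. y < x) w) = card (set (filter (\<lambda>y. y < x) w))"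
    using assms by (intro distinct_card[symmetric] distinct_filter) (auto simp: permutations_of_set_def)
  also have "set (filter (\<lambda>y. y < x) w) = {y \<in> A. y < x}"
    using assms by (auto simp: permutations_of_set_def)
  finally show ?thesis
    by (simp add: inv_count_Cons rank_def)
qed

lemma avoids_Cons:
  assumes "\<sigma> \<noteq> []"
  shows "avoids (x # w) \<sigma> \<longleftrightarrow>
    \<not> (length \<sigma> \<le> Suc (length w) \<and> order_isomorphic (take (length \<sigma>) (x # w)) \<sigma>) \<and> avoids w \<sigma>"
proof -
  have "(\<exists>j. P j) \<longleftrightarrow> P 0 \<or> (\<exists>j. P (Suc j))" for P :: "nat \<Rightarrow> bool"
    by (metis not0_implies_Suc)
  from this[of "\<lambda>j. j + length \<sigma> \<le> length (x # w) \<and> order_isomorphic (take (length \<sigma>) (drop j (x # w))) \<sigma>"]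
  show ?thesis
    unfolding avoids_def by auto
qed

lemma avoids_short: "length w < length \<sigma> \<Longrightarrow> avoids w \<sigma>"
  by (auto simp: avoids_def)

lemma avoids_132_Cons:
  "avoids (x # a # c # w) [1,3,2] \<longleftrightarrow> \<not> (x < c \<and> c < a) \<and> avoids (a # c # w) [1,3,2]"
proof -
  have "order_isomorphic [x, a, c] [1,3,2] \<longleftrightarrow> x < c \<and> c < a"
    by (auto simp: order_isomorphic_def less_Suc_eq numeral_3_eq_3)
  then show ?thesis by (subst avoids_Cons) auto
qed

lemma avoids_123_Cons:
  "avoids (x # a # c # w) [1,2,3] \<longleftrightarrow> \<not> (x < a \<and> a < c) \<and> avoids (a # c # w) [1,2,3]"
proof -
  have "order_isomorphic [x, a, c] [1,2,3] \<longleftrightarrow> x < a \<and> a < c"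
    by (auto simp: order_isomorphic_def less_Suc_eq numeral_3_eq_3)
  then show ?thesis by (subst avoids_Cons) auto
qed

section \<open>Weighted sums over avoiders, by first letter\<close>

definition avoid_term :: "nat list \<Rightarrow> real \<Rightarrow> nat list \<Rightarrow> real" where
  "avoid_term \<sigma> q \<pi> = (if avoids \<pi> \<sigma> then q ^ inv_count \<pi> else 0)"

text \<open>Unnormalised, and over an arbitrary finite set of letters, so that deleting a letter
  needs no relabelling.\<close>

definition avoid_weight :: "nat list \<Rightarrow> real \<Rightarrow> nat set \<Rightarrow> real" where
  "avoid_weight \<sigma> q A = (\<Sum>\<pi>\<in>permutations_of_set A. avoid_term \<sigma> q \<pi>)"

definition avoid_start :: "nat list \<Rightarrow> real \<Rightarrow> nat set \<Rightarrow> nat \<Rightarrow> real" where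
  "avoid_start \<sigma> q A x = (\<Sum>w\<in>permutations_of_set (A - {x}). avoid_term \<sigma> q (x # w))"

lemma avoid_term_nonneg: "0 \<le> q \<Longrightarrow> 0 \<le> avoid_term \<sigma> q \<pi>"
  by (simp add: avoid_term_def)

lemma avoid_weight_eq_sum_start:
  assumes "finite A" "A \<noteq> {}"
  shows "avoid_weight \<sigma> q A = (\<Sum>x\<in>A. avoid_start \<sigma> q A x)"
  unfolding avoid_weight_def avoid_start_def by (rule sum_permutations_of_set_Cons[OF assms])

text \<open>The double sum is the weight of the avoiders on \<open>B\<close> that prepending
  \<open>x\<close> spoils. As c < a, no occurrence starts at \<open>a\<close>, so \<open>a\<close>
  can be deleted at the cost of its \<open>rank B a\<close> inversions.\<close>

lemma avoid_start_132_rec: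
  assumes "finite A" "x \<in> A" "A \<noteq> {x}"
  defines "B \<equiv> A - {x}"
  shows "avoid_start [1,3,2] q A x = q ^ rank A x * (avoid_weight [1,3,2] q B -
    (\<Sum>a\<in>B. \<Sum>c\<in>B. if x < c \<and> c < a then q ^ rank B a * avoid_start [1,3,2] q (B - {a}) c else 0))"
proof -
  let ?t = "avoid_term [1,3,2] q"
  have B: "finite B" "B \<noteq> {}" using assms by auto
  have *: "(\<Sum>w\<in>permutations_of_set (B - {a}). ?t (x # a # w)) =
      q ^ rank A x * ((\<Sum>w\<in>permutations_of_set (B - {a}). ?t (a # w)) -
        (\<Sum>c\<in>B. if x < c \<and> c < a then q ^ rank B a * avoid_start [1,3,2] q (B - {a}) c else 0))"
    if a: "a \<in> B" for a
  proof (cases "B - {a} = {}")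
    case True
    then have "B = {a}" using a by auto
    then have "A = {x, a}" using assms a by auto
    have "?t [x, a] = q ^ rank A x * ?t [a]"
      using inv_count_Cons_permutation[of "[a]" A x] assms(2) a unfolding B_def[symmetric]
      by (simp add: avoid_term_def avoids_short power_add \<open>B = {a}\<close>)
    then show ?thesis by (simp add: \<open>B = {a}\<close>)
  next
    case False
    have fin: "finite (B - {a})" using B by simp
    have "?t (x # a # c # w) = q ^ rank A x * (?t (a # c # w) -
       (if x < c \<and> c < a then q ^ rank B a * ?t (c # w) else 0))"
      if c: "c \<in> B - {a}" and w: "w \<in> permutations_of_set (B - {a} - {c})" for c w
    proof -
      have cw: "c # w \<in> permutations_of_set (B - {a})"
        using c w by (auto simp: permutations_of_set_def)
      then have acw: "a # c # w \<in> permutations_of_set (A - {x})"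
        using a unfolding B_def by (auto simp: permutations_of_set_def)
      have "avoids (a # c # w) [1,3,2] \<longleftrightarrow> avoids (c # w) [1,3,2]" if "c < a"
        using that by (cases w) (auto simp: avoids_132_Cons avoids_short simp del: One_nat_def)
      then show ?thesis
        using inv_count_Cons_permutation[OF cw] inv_count_Cons_permutation[OF acw]
        by (auto simp: avoid_term_def avoids_132_Cons power_add algebra_simps simp del: One_nat_def)
    qed
    then have "(\<Sum>w\<in>permutations_of_set (B - {a}). ?t (x # a # w)) =
      (\<Sum>c\<in>B - {a}. \<Sum>w\<in>permutations_of_set (B - {a} - {c}). q ^ rank A x * (?t (a # c # w) -
       (if x < c \<and> c < a then q ^ rank B a * ?t (c # w) else 0)))"
      unfolding sum_permutations_of_set_Cons[OF fin False] by (intro sum.cong refl) auto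
    also have "\<dots> = q ^ rank A x * ((\<Sum>c\<in>B - {a}. \<Sum>w\<in>permutations_of_set (B - {a} - {c}). ?t (a # c # w)) -
       (\<Sum>c\<in>B - {a}. if x < c \<and> c < a then q ^ rank B a * avoid_start [1,3,2] q (B - {a}) c else 0))"
      unfolding avoid_start_def sum_distrib_left[symmetric] sum_subtractf[symmetric]
      by (intro arg_cong2[where f = "(*)"] refl sum.cong) (auto simp: sum_distrib_left sum_subtractf)
    also have "(\<Sum>c\<in>B - {a}. \<Sum>w\<in>permutations_of_set (B - {a} - {c}). ?t (a # c # w)) =
       (\<Sum>w\<in>permutations_of_set (B - {a}). ?t (a # w))"
      by (rule sum_permutations_of_set_Cons[OF fin False, symmetric])
    also have "(\<Sum>c\<in>B - {a}. if x < c \<and> c < a then q ^ rank B a * avoid_start [1,3,2] q (B - {a}) c else 0) =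
       (\<Sum>c\<in>B. if x < c \<and> c < a then q ^ rank B a * avoid_start [1,3,2] q (B - {a}) c else 0)"
      using B by (intro sum.mono_neutral_left) auto
    finally show ?thesis .
  qed
  show ?thesis
    unfolding avoid_start_def[of _ _ A] avoid_weight_def B_def[symmetric] sum_permutations_of_set_Cons[OF B]
      sum_subtractf[symmetric] sum_distrib_left[of "q ^ rank A x" _ B]
    by (rule sum.cong[OF refl *])
qed

lemma avoid_start_132:
  assumes "finite A" "x \<in> A"
  shows "avoid_start [1,3,2] q A x = start_weight q (card A) (rank A x)"
  using assms
proof (induction "card A" arbitrary: A x rule: less_induct)
  case less
  show ?case
  proof (cases "A = {x}")
    case True
    have "rank {x} x = 0" by (auto simp: rank_def)
    then show ?thesis using True
      by (simp add: avoid_start_def avoid_term_def avoids_short inv_count_Cons)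
  next
    case False
    define B where "B = A - {x}"
    have B: "finite B" "B \<noteq> {}" using less.prems False by (auto simp: B_def)
    then obtain n where cB: "card B = Suc n"
      by (metis card_eq_0_iff not0_implies_Suc)
    have cA: "card A = Suc (Suc n)"
      unfolding card.remove[OF less.prems] B_def[symmetric] cB ..
    define r where "r = rank A x"
    have "avoid_weight [1,3,2] q B = (\<Sum>a\<in>B. start_weight q (Suc n) (rank B a))"
      unfolding avoid_weight_eq_sum_start[OF B] using less.hyps[of B] cA cB B by (intro sum.cong) auto
    also have "\<dots> = (\<Sum>c<Suc n. start_weight q (Suc n) c)"
      by (rule sum_rank[OF B(1), unfolded cB])
    finally have T: "avoid_weight [1,3,2] q B = (\<Sum>c<Suc n. start_weight q (Suc n) c)" .
    have "(\<Sum>a\<in>B. \<Sum>c\<in>B. if x < c \<and> c < a then q ^ rank B a * avoid_start [1,3,2] q (B - {a}) c else 0) =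
      (\<Sum>a\<in>B. \<Sum>c\<in>B. if r \<le> rank B c \<and> rank B c < rank B a then q ^ rank B a * start_weight q n (rank B c) else 0)"
    proof (intro sum.cong refl)
      fix a c assume ac: "a \<in> B" "c \<in> B"
      have "x < c \<longleftrightarrow> r \<le> rank B c"
        using rank_remove_less_iff[of A x c] ac less.prems by (auto simp: B_def r_def not_less[symmetric])
      moreover have "c < a \<longleftrightarrow> rank B c < rank B a"
        using rank_less_iff[OF B(1)] ac by auto
      \<comment> \<open>The deleted letter lies above \<open>c\<close>, hence the rank of
        \<open>c\<close> does not change.\<close>
      moreover have "avoid_start [1,3,2] q (B - {a}) c = start_weight q n (rank B c)" if "c < a"
        using less.hyps[of "B - {a}" c] ac B cA cB that by (simp add: rank_remove)
      ultimately show "(if x < c \<and> c < a then q ^ rank B a * avoid_start [1,3,2] q (B - {a}) c else 0) =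
        (if r \<le> rank B c \<and> rank B c < rank B a then q ^ rank B a * start_weight q n (rank B c) else 0)"
        by auto
    qed
    also have "\<dots> = (\<Sum>a\<in>B. \<Sum>k<Suc n. if r \<le> k \<and> k < rank B a then q ^ rank B a * start_weight q n k else 0)"
      by (intro sum.cong[OF refl] sum_rank[OF B(1), unfolded cB])
    also have "\<dots> = (\<Sum>i<Suc n. \<Sum>k<Suc n. if r \<le> k \<and> k < i then q ^ i * start_weight q n k else 0)"
      by (rule sum_rank[OF B(1), unfolded cB])
    also have "\<dots> = (\<Sum>i<Suc n. q ^ i * (\<Sum>k\<in>{r..<i}. start_weight q n k))"
    proof (intro sum.cong refl)
      fix i assume "i \<in> {..<Suc n}"
      then have "{k \<in> {..<Suc n}. r \<le> k \<and> k < i} = {r..<i}" by auto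
      then show "(\<Sum>k<Suc n. if r \<le> k \<and> k < i then q ^ i * start_weight q n k else 0) =
         q ^ i * (\<Sum>k\<in>{r..<i}. start_weight q n k)"
        by (subst sum.inter_filter[symmetric]) (simp_all only: finite_lessThan sum_distrib_left)
    qed
    also have "\<dots> = (\<Sum>i\<in>{r..<Suc n}. q ^ i * (\<Sum>k\<in>{r..<i}. start_weight q n k))"
      by (intro sum.mono_neutral_right) auto
    also have "\<dots> = (\<Sum>c\<in>{r..<n}. start_weight q n c * qsum q (Suc c) (Suc n))"
      by (rule sum_swap_triangle_qsum)
    finally show ?thesis
      unfolding avoid_start_132_rec[OF less.prems False, of q, folded B_def r_def] T cA
        start_weight.simps(3) r_def[symmetric] by simp
  qed
qed

section \<open>Lower bounds for 123-avoiders\<close>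

lemma avoid_start_123_smaller:
  assumes "finite A" "x \<in> A" "a \<in> A" "a < x"
  shows "(\<Sum>w\<in>permutations_of_set (A - {x} - {a}). avoid_term [1,2,3] q (x # a # w)) =
         q ^ rank A x * avoid_start [1,2,3] q (A - {x}) a"
  unfolding avoid_start_def sum_distrib_left
proof (intro sum.cong refl)
  fix w assume w: "w \<in> permutations_of_set (A - {x} - {a})"
  then have "a # w \<in> permutations_of_set (A - {x})"
    using assms by (auto simp: permutations_of_set_def)
  note inv_count_Cons_permutation[OF this]
  moreover have "avoids (x # a # w) [1,2,3] \<longleftrightarrow> avoids (a # w) [1,2,3]"
    using assms(4) by (cases w) (auto simp: avoids_123_Cons avoids_short simp del: One_nat_def)
  ultimately show "avoid_term [1,2,3] q (x # a # w) = q ^ rank A x * avoid_term [1,2,3] q (a # w)"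
    by (simp add: avoid_term_def power_add)
qed

text \<open>Keeps only the words with third letter b < a: the descent from \<open>a\<close> to
  \<open>b\<close> prevents occurrences starting at \<open>x\<close> or at \<open>a\<close>. All
  other words contribute nonnegative terms.\<close>

lemma avoid_start_123_larger:
  assumes "finite A" "x \<in> A" "a \<in> A - {x}" "0 \<le> q"
  shows "q ^ rank A x * (q ^ rank (A - {x}) a *
           (\<Sum>b | b \<in> A - {x} \<and> b < a. avoid_start [1,2,3] q (A - {x} - {a}) b)) \<le>
         (\<Sum>w\<in>permutations_of_set (A - {x} - {a}). avoid_term [1,2,3] q (x # a # w))"
proof (cases "A - {x} - {a} = {}")
  case True
  then have "{b. b \<in> A - {x} \<and> b < a} = {}" by auto
  then show ?thesis
    unfolding True using avoid_term_nonneg[OF assms(4)] by (simp only: sum.empty permutations_of_set_empty) simp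
next
  case False
  define B where "B = A - {x}"
  have fin: "finite (A - {x} - {a})" using assms by simp
  have "q ^ rank A x * (q ^ rank B a * (\<Sum>b | b \<in> B \<and> b < a. avoid_start [1,2,3] q (B - {a}) b)) =
    (\<Sum>b | b \<in> B \<and> b < a. \<Sum>w\<in>permutations_of_set (B - {a} - {b}). avoid_term [1,2,3] q (x # a # b # w))"
    unfolding avoid_start_def sum_distrib_left
  proof (intro sum.cong refl)
    fix b w assume b: "b \<in> {b. b \<in> B \<and> b < a}" and w: "w \<in> permutations_of_set (B - {a} - {b})"
    have bw: "b # w \<in> permutations_of_set (B - {a})"
      using b w by (auto simp: permutations_of_set_def)
    then have abw: "a # b # w \<in> permutations_of_set (A - {x})"
      using assms by (auto simp: permutations_of_set_def B_def)
    have "avoids (x # a # b # w) [1,2,3] \<longleftrightarrow> avoids (b # w) [1,2,3]"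
      using b by (cases w) (auto simp: avoids_123_Cons avoids_short simp del: One_nat_def)
    then show "q ^ rank A x * (q ^ rank B a * avoid_term [1,2,3] q (b # w)) = avoid_term [1,2,3] q (x # a # b # w)"
      using inv_count_Cons_permutation[OF bw] inv_count_Cons_permutation[OF abw]
      by (simp add: avoid_term_def power_add)
  qed
  also have "\<dots> \<le> (\<Sum>b\<in>B - {a}. \<Sum>w\<in>permutations_of_set (B - {a} - {b}). avoid_term [1,2,3] q (x # a # b # w))"
    using assms by (intro sum_mono2 sum_nonneg avoid_term_nonneg) (auto simp: B_def)
  also have "\<dots> = (\<Sum>w\<in>permutations_of_set (B - {a}). avoid_term [1,2,3] q (x # a # w))"
    unfolding B_def by (rule sum_permutations_of_set_Cons[OF fin False, symmetric])
  finally show ?thesis by (simp only: B_def)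
qed

lemma avoid_start_123_ge:
  assumes "finite A" "x \<in> A" "q \<ge> 1"
  shows "start_weight q (card A) (rank A x) \<le> avoid_start [1,2,3] q A x"
  using assms(1,2)
proof (induction "card A" arbitrary: A x rule: less_induct)
  case less
  have q0: "0 \<le> q" using assms by simp
  define B where "B = A - {x}"
  define r where "r = rank A x"
  have B: "finite B" using less.prems by (simp add: B_def)
  have cA: "card A = Suc (card B)"
    unfolding B_def by (rule card.remove[OF less.prems])
  show ?case
  proof (cases "card B \<le> 1")
    \<comment> \<open>With at most two letters every word avoids a pattern of length 3, and both
      sides equal q to the rank of \<open>x\<close>.\<close>
    case True
    have "start_weight q (card A) (rank A x) = q ^ rank A x"
      using True cA by (cases "card B") (auto simp: start_weight.simps(3))
    also have "\<dots> = avoid_start [1,2,3] q A x"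
    proof -
      obtain w where w: "permutations_of_set B = {w}" "length w = card B"
      proof (cases "card B = 0")
        case True
        then show ?thesis using B that by auto
      next
        case False
        then have "card B = 1" using True by simp
        then obtain b where "B = {b}" by (auto simp: card_1_singleton_iff)
        then show ?thesis using that by auto
      qed
      have "inv_count w = 0"
        using w True by (cases w; cases "tl w") (auto simp: inv_count_Cons)
      moreover have "w \<in> permutations_of_set (A - {x})"
        using w by (simp add: B_def)
      note inv_count_Cons_permutation[OF this]
      moreover have "avoids (x # w) [1,2,3]"
        using w True by (intro avoids_short) auto
      ultimately show ?thesis
        using w by (simp add: avoid_start_def avoid_term_def B_def[symmetric])
    qed
    finally show ?thesis by simp
  next
    case False
    then obtain n where cB: "card B = Suc (Suc n)"
      by (metis One_nat_def Suc_leI Suc_le_D le_SucE not_less_eq_eq not0_implies_Suc)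
    have less_iff: "rank B a < r \<longleftrightarrow> a < x" if "a \<in> B" for a
      using rank_remove_less_iff[OF less.prems, of a] that by (simp add: B_def r_def)
    have r: "r \<le> Suc (Suc n)"
      using rank_less_card[OF less.prems] cA cB by (simp add: r_def)
    \<comment> \<open>\<open>f i\<close> is the summand of \<open>start_weight_le\<close> for a
      second letter of rank \<open>i\<close> in \<open>B\<close>; the cut at \<open>r\<close>
      separates the letters below \<open>x\<close> from those above.\<close>
    define f where "f = (\<lambda>i. if i < r then start_weight q (Suc (Suc n)) i
                            else q ^ i * (\<Sum>b<i. start_weight q (Suc n) b))"
    have "start_weight q (card A) (rank A x) \<le>
      q ^ r * ((\<Sum>a<r. start_weight q (Suc (Suc n)) a) +
             (\<Sum>a\<in>{r..<Suc (Suc n)}. q ^ a * (\<Sum>b<a. start_weight q (Suc n) b)))"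
      unfolding cA cB r_def[symmetric] by (rule start_weight_le[OF assms(3) r])
    also have "\<dots> = q ^ r * (\<Sum>i<Suc (Suc n). f i)"
      unfolding sum_lessThan_split[OF r] f_def by simp
    also have "\<dots> = (\<Sum>a\<in>B. q ^ r * f (rank B a))"
      unfolding sum_distrib_left[symmetric] by (rule arg_cong[OF sum_rank[OF B, unfolded cB, symmetric]])
    also have "\<dots> \<le> (\<Sum>a\<in>B. \<Sum>w\<in>permutations_of_set (B - {a}). avoid_term [1,2,3] q (x # a # w))"
    proof (intro sum_mono)
      fix a assume a: "a \<in> B"
      show "q ^ r * f (rank B a) \<le> (\<Sum>w\<in>permutations_of_set (B - {a}). avoid_term [1,2,3] q (x # a # w))"
      proof (cases "a < x")
        case True
        have "q ^ r * f (rank B a) \<le> q ^ r * avoid_start [1,2,3] q B a"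
          using less.hyps[of B a] cA cB B a True less_iff[OF a] q0 by (intro mult_left_mono) (auto simp: f_def)
        also have "\<dots> = (\<Sum>w\<in>permutations_of_set (B - {a}). avoid_term [1,2,3] q (x # a # w))"
          unfolding B_def r_def
          by (rule avoid_start_123_smaller[OF less.prems _ True, symmetric]) (use a in \<open>simp add: B_def\<close>)
        finally show ?thesis .
      next
        case False
        have "(\<Sum>b<rank B a. start_weight q (Suc n) b) =
            (\<Sum>k<Suc (Suc n). if k < rank B a then start_weight q (Suc n) k else 0)"
        proof -
          have "{k \<in> {..<Suc (Suc n)}. k < rank B a} = {..<rank B a}"
            using rank_less_card[OF B a] cB by auto
          then show ?thesis
            by (subst sum.inter_filter[symmetric]) (simp_all only: finite_lessThan)
        qed
        also have "\<dots> = (\<Sum>b\<in>B. if rank B b < rank B a then start_weight q (Suc n) (rank B b) else 0)"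
          by (rule sum_rank[OF B, unfolded cB, symmetric])
        also have "\<dots> = (\<Sum>b | b \<in> B \<and> rank B b < rank B a. start_weight q (Suc n) (rank B b))"
          by (rule sum.inter_filter[OF B, symmetric])
        also have "{b. b \<in> B \<and> rank B b < rank B a} = {b. b \<in> B \<and> b < a}"
          using rank_less_iff[OF B] a by auto
        also have "(\<Sum>b | b \<in> B \<and> b < a. start_weight q (Suc n) (rank B b)) \<le>
            (\<Sum>b | b \<in> B \<and> b < a. avoid_start [1,2,3] q (B - {a}) b)"
        proof (intro sum_mono)
          fix b assume b: "b \<in> {b. b \<in> B \<and> b < a}"
          have "card (B - {a}) = Suc n"
            using a B cB by simp
          moreover have "rank (B - {a}) b = rank B b"
            using b by (intro rank_remove) auto
          ultimately show "start_weight q (Suc n) (rank B b) \<le> avoid_start [1,2,3] q (B - {a}) b"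
            using less.hyps[of "B - {a}" b] cA cB B b by auto
        qed
        finally have "q ^ r * f (rank B a) \<le> q ^ r * (q ^ rank B a *
            (\<Sum>b | b \<in> B \<and> b < a. avoid_start [1,2,3] q (B - {a}) b))"
          using False less_iff[OF a] q0 by (simp add: f_def mult_left_mono)
        also have "\<dots> \<le> (\<Sum>w\<in>permutations_of_set (B - {a}). avoid_term [1,2,3] q (x # a # w))"
          using avoid_start_123_larger[OF less.prems _ q0, of a] a by (simp only: B_def[symmetric] r_def)
        finally show ?thesis .
      qed
    qed
    also have "\<dots> = avoid_start [1,2,3] q A x"
      unfolding avoid_start_def[of _ _ A] B_def[symmetric] using B cB
      by (intro sum_permutations_of_set_Cons[symmetric]) auto
    finally show ?thesis .
  qed
qed

lemma avoid_weight_empty [simp]: "\<sigma> \<noteq> [] \<Longrightarrow> avoid_weight \<sigma> q {} = 1"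
  by (simp add: avoid_weight_def avoid_term_def avoids_short)

lemma avoid_weight_132_le_123:
  assumes "finite A" "q \<ge> 1"
  shows "avoid_weight [1,3,2] q A \<le> avoid_weight [1,2,3] q A"
proof (cases "A = {}")
  case False
  show ?thesis
    unfolding avoid_weight_eq_sum_start[OF assms(1) False]
    using assms by (intro sum_mono) (simp only: avoid_start_132 avoid_start_123_ge)
qed simp

lemma avoid_weight_132_pos:
  assumes "finite A" "0 < q"
  shows "0 < avoid_weight [1,3,2] q A"
proof (cases "A = {}")
  case False
  then obtain n where n: "card A = Suc n"
    using assms by (metis card_eq_0_iff not0_implies_Suc)
  have "avoid_weight [1,3,2] q A = (\<Sum>x\<in>A. start_weight q (card A) (rank A x))"
    unfolding avoid_weight_eq_sum_start[OF assms(1) False]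
    using assms by (intro sum.cong refl avoid_start_132)
  also have "\<dots> = (\<Sum>c<Suc n. start_weight q (Suc n) c)"
    unfolding sum_rank[OF assms(1)] n ..
  finally show ?thesis
    using start_weight_total_pos[OF assms(2)] by simp
qed simp

subsection \<open>Submultiplicativity and reversal\<close>

lemma sum_permutations_of_set_append:
  fixes f :: "'a list \<Rightarrow> real"
  assumes "finite A" "m \<le> card A"
  shows "(\<Sum>\<pi>\<in>permutations_of_set A. f \<pi>) =
    (\<Sum>U | U \<subseteq> A \<and> card U = m. \<Sum>u\<in>permutations_of_set U. \<Sum>v\<in>permutations_of_set (A - U). f (u @ v))"
proof -
  have fin: "finite {U. U \<subseteq> A \<and> card U = m}"
    using assms by simp
  have "(\<Sum>U | U \<subseteq> A \<and> card U = m. \<Sum>u\<in>permutations_of_set U. \<Sum>v\<in>permutations_of_set (A - U). f (u @ v)) =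
    (\<Sum>(U, u, v)\<in>(SIGMA U:{U. U \<subseteq> A \<and> card U = m}. permutations_of_set U \<times> permutations_of_set (A - U)). f (u @ v))"
    using fin by (simp add: sum.Sigma sum.cartesian_product)
  also have "\<dots> = (\<Sum>\<pi>\<in>permutations_of_set A. f \<pi>)"
  proof (rule sum.reindex_bij_witness[where j = "\<lambda>(U, u, v). u @ v" and
        i = "\<lambda>\<pi>. (set (take m \<pi>), take m \<pi>, drop m \<pi>)"])
    fix p assume "p \<in> (SIGMA U:{U. U \<subseteq> A \<and> card U = m}. permutations_of_set U \<times> permutations_of_set (A - U))"
    then obtain U u v where p: "p = (U, u, v)" "U \<subseteq> A" "card U = m" "set u = U" "distinct u" "set v = A - U" "distinct v"
      by (auto simp: permutations_of_set_def)
    then have "length u = m" by (auto simp: distinct_card)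
    then show "(set (take m (case p of (U, u, v) \<Rightarrow> u @ v)), take m (case p of (U, u, v) \<Rightarrow> u @ v),
        drop m (case p of (U, u, v) \<Rightarrow> u @ v)) = p"
      using p by auto
    show "(case p of (U, u, v) \<Rightarrow> u @ v) \<in> permutations_of_set A"
      using p by (auto simp: permutations_of_set_def)
    show "f (case p of (U, u, v) \<Rightarrow> u @ v) = (case p of (U, u, v) \<Rightarrow> f (u @ v))"
      using p by auto
  next
    fix \<pi> assume "\<pi> \<in> permutations_of_set A"
    then have \<pi>: "set \<pi> = A" "distinct \<pi>" by (auto simp: permutations_of_set_def)
    then have "length \<pi> = card A" by (auto simp: distinct_card)
    then have len: "length (take m \<pi>) = m" using assms by simp
    have A: "A = set (take m \<pi>) \<union> set (drop m \<pi>)"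
      using \<pi>(1) by (metis append_take_drop_id set_append)
    moreover have "set (take m \<pi>) \<inter> set (drop m \<pi>) = {}"
      using \<pi>(2) by (metis append_take_drop_id distinct_append)
    ultimately have "set (drop m \<pi>) = A - set (take m \<pi>)" by auto
    moreover have "card (set (take m \<pi>)) = m"
      using len \<pi> distinct_card[of "take m \<pi>"] by simp
    ultimately show "(set (take m \<pi>), take m \<pi>, drop m \<pi>) \<in>
        (SIGMA U:{U. U \<subseteq> A \<and> card U = m}. permutations_of_set U \<times> permutations_of_set (A - U))"
      using \<pi> A by (auto simp: permutations_of_set_def)
  qed auto
  finally show ?thesis by simp
qed

text \<open>The number of inversions across the cut depends only on the two sets of letters, not on
  their order. This makes the two blocks independent.\<close>

lemma inv_count_append:
  assumes "distinct u" "distinct v"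
  shows "inv_count (u @ v) = inv_count u + inv_count v + card {(a, b). a \<in> set u \<and> b \<in> set v \<and> b < a}"
  using assms(1)
proof (induction u)
  case (Cons x u)
  have "{(a, b). a \<in> set (x # u) \<and> b \<in> set v \<and> b < a} =
    {x} \<times> {b \<in> set v. b < x} \<union> {(a, b). a \<in> set u \<and> b \<in> set v \<and> b < a}" by auto
  moreover have "finite {(a, b). a \<in> set u \<and> b \<in> set v \<and> b < a}"
    by (rule finite_subset[of _ "set u \<times> set v"]) auto
  ultimately have "card {(a, b). a \<in> set (x # u) \<and> b \<in> set v \<and> b < a} =
     card ({x} \<times> {b \<in> set v. b < x}) + card {(a, b). a \<in> set u \<and> b \<in> set v \<and> b < a}"
    using Cons by (simp only:) (intro card_Un_disjoint, auto)
  also have "card ({x} \<times> {b \<in> set v. b < x}) = length (filter (\<lambda>y. y < x) v)"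
    using assms(2) distinct_card[of "filter (\<lambda>y. y < x) v"] by (simp add: card_cartesian_product)
  finally show ?case
    using Cons by (simp add: inv_count_Cons)
qed simp

lemma inv_count_map:
  assumes "\<And>a b. a \<in> set w \<Longrightarrow> b \<in> set w \<Longrightarrow> f a < f b \<longleftrightarrow> a < b"
  shows "inv_count (map f w) = inv_count w"
  unfolding inv_count_def using assms by (intro arg_cong[where f = card]) auto

lemma order_isomorphic_map:
  assumes "\<And>a b. a \<in> set w \<Longrightarrow> b \<in> set w \<Longrightarrow> f a < f b \<longleftrightarrow> a < b"
  shows "order_isomorphic (map f w) \<sigma> \<longleftrightarrow> order_isomorphic w \<sigma>"
  unfolding order_isomorphic_def using assms by auto

lemma avoids_map:
  assumes "\<And>a b. a \<in> set w \<Longrightarrow> b \<in> set w \<Longrightarrow> f a < f b \<longleftrightarrow> a < b"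
  shows "avoids (map f w) \<sigma> \<longleftrightarrow> avoids w \<sigma>"
proof -
  have "order_isomorphic (take l (drop j (map f w))) \<sigma> \<longleftrightarrow> order_isomorphic (take l (drop j w)) \<sigma>" for j l
    unfolding drop_map take_map
    by (intro order_isomorphic_map assms) (meson in_set_dropD in_set_takeD)+
  then show ?thesis by (simp add: avoids_def)
qed

lemma avoid_weight_card:
  assumes "finite A"
  shows "avoid_weight \<sigma> q A = avoid_weight \<sigma> q {..<card A}"
proof -
  have inj: "inj_on (rank A) A" and im: "rank A ` A = {..<card A}"
    using rank_bij[OF assms] by (auto simp: bij_betw_def)
  have "inj_on (map (rank A)) (permutations_of_set A)"
    using inj by (auto simp: inj_on_def permutations_of_set_def intro: map_inj_on)
  then have "avoid_weight \<sigma> q {..<card A} = (\<Sum>w\<in>permutations_of_set A. avoid_term \<sigma> q (map (rank A) w))"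
    unfolding avoid_weight_def im[symmetric] permutations_of_set_image_inj[OF inj]
    by (simp add: sum.reindex)
  also have "\<dots> = avoid_weight \<sigma> q A"
    unfolding avoid_weight_def
  proof (intro sum.cong refl)
    fix w assume "w \<in> permutations_of_set A"
    then have "rank A a < rank A b \<longleftrightarrow> a < b" if "a \<in> set w" "b \<in> set w" for a b
      using that rank_less_iff[OF assms] by (auto simp: permutations_of_set_def)
    then show "avoid_term \<sigma> q (map (rank A) w) = avoid_term \<sigma> q w"
      by (simp add: avoid_term_def avoids_map inv_count_map)
  qed
  finally show ?thesis by simp
qed

lemma avoids_append:
  assumes "avoids (u @ v) \<sigma>"
  shows "avoids u \<sigma>" "avoids v \<sigma>"
proof -
  show "avoids u \<sigma>"
    unfolding avoids_def
  proof (intro notI, elim exE conjE)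
    fix j assume j: "j + length \<sigma> \<le> length u" "order_isomorphic (take (length \<sigma>) (drop j u)) \<sigma>"
    then have "j + length \<sigma> \<le> length (u @ v)"
      "order_isomorphic (take (length \<sigma>) (drop j (u @ v))) \<sigma>" by simp_all
    with assms show False unfolding avoids_def by blast
  qed
  show "avoids v \<sigma>"
    unfolding avoids_def
  proof (intro notI, elim exE conjE)
    fix j assume j: "j + length \<sigma> \<le> length v" "order_isomorphic (take (length \<sigma>) (drop j v)) \<sigma>"
    then have "(length u + j) + length \<sigma> \<le> length (u @ v)"
      "order_isomorphic (take (length \<sigma>) (drop (length u + j) (u @ v))) \<sigma>" by simp_all
    with assms show False unfolding avoids_def by blast
  qed
qed

text \<open>The classical product formula for the inversion generating function: the choice of the
  first letter contributes one factor \<open>q_int\<close>.\<close>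

lemma sum_inv_count:
  assumes "finite A"
  shows "(\<Sum>\<pi>\<in>permutations_of_set A. q ^ inv_count \<pi>) = q_fact (card A) q"
  using assms
proof (induction "card A" arbitrary: A)
  case 0
  then show ?case by (simp add: q_fact_def)
next
  case (Suc n)
  then have "A \<noteq> {}" by auto
  have "(\<Sum>\<pi>\<in>permutations_of_set A. q ^ inv_count \<pi>) =
        (\<Sum>x\<in>A. \<Sum>w\<in>permutations_of_set (A - {x}). q ^ rank A x * q ^ inv_count w)"
    unfolding sum_permutations_of_set_Cons[OF Suc(3) \<open>A \<noteq> {}\<close>]
    by (intro sum.cong refl) (simp add: inv_count_Cons_permutation power_add)
  also have "\<dots> = (\<Sum>x\<in>A. q ^ rank A x * q_fact n q)"
  proof (rule sum.cong[OF refl])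
    fix x assume "x \<in> A"
    then have "card (A - {x}) = n" "finite (A - {x})" using Suc by auto
    then show "(\<Sum>w\<in>permutations_of_set (A - {x}). q ^ rank A x * q ^ inv_count w) = q ^ rank A x * q_fact n q"
      using Suc.hyps(1)[of "A - {x}"] by (simp flip: sum_distrib_left)
  qed
  also have "\<dots> = q_int (Suc n) q * q_fact n q"
    unfolding sum_distrib_right[symmetric] sum_rank[OF Suc(3)] q_int_def Suc(2)[symmetric] ..
  finally show ?case
    unfolding Suc(2)[symmetric] by (simp add: q_fact_def mult.commute)
qed

lemma q_fact_pos: "0 < q \<Longrightarrow> 0 < q_fact n q"
  unfolding q_fact_def q_int_def by (intro prod_pos sum_pos) (auto simp: lessThan_empty_iff)

lemma avoid_prob_eq: "avoid_prob n \<sigma> q = avoid_weight \<sigma> q {1..n} / q_fact n q"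
  unfolding avoid_prob_def avoid_weight_def avoid_term_def mallows_prob_def
  by (simp add: sum.inter_filter[symmetric] sum_divide_distrib)

lemma avoid_prob_eq_card: "avoid_prob n \<sigma> q = avoid_weight \<sigma> q {..<n} / q_fact n q"
  unfolding avoid_prob_eq by (subst avoid_weight_card) simp_all

lemma avoid_prob_le_1:
  assumes "0 < q"
  shows "avoid_prob n \<sigma> q \<le> 1"
proof -
  have "avoid_weight \<sigma> q {1..n} \<le> (\<Sum>\<pi>\<in>permutations_of_set {1..n}. q ^ inv_count \<pi>)"
    unfolding avoid_weight_def avoid_term_def using assms by (intro sum_mono) auto
  then show ?thesis
    unfolding avoid_prob_eq using q_fact_pos[OF assms] sum_inv_count[of "{1..n}" q] by simp
qed

text \<open>The relative orders of the first \<open>m\<close> and of the last \<open>n\<close> entries are independent.\<close>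

lemma avoid_prob_submult:
  assumes "0 < q"
  shows "avoid_prob (m + n) \<sigma> q \<le> avoid_prob m \<sigma> q * avoid_prob n \<sigma> q"
proof -
  define A where "A = {1..m + n}"
  define Q where "Q = (\<lambda>U. q ^ card {(a, b). a \<in> U \<and> b \<in> A - U \<and> b < a})"
  \<comment> \<open>\<open>C\<close> is the Gaussian binomial coefficient. Its relation to
    \<open>q_fact\<close> comes from applying the block decomposition to all permutations.\<close>
  define C where "C = (\<Sum>U | U \<subseteq> A \<and> card U = m. Q U)"
  have A: "finite A" "card A = m + n" by (auto simp: A_def)
  have U: "finite U" "card (A - U) = n" if "U \<in> {U. U \<subseteq> A \<and> card U = m}" for U
    using that A by (auto simp: card_Diff_subset finite_subset)
  have Q: "q ^ inv_count (u @ v) = Q U * (q ^ inv_count u * q ^ inv_count v)"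
    if "u \<in> permutations_of_set U" "v \<in> permutations_of_set (A - U)" for u v U
    using that by (simp add: permutations_of_set_def inv_count_append Q_def power_add)
  have "q_fact (m + n) q = (\<Sum>\<pi>\<in>permutations_of_set A. q ^ inv_count \<pi>)"
    using A by (simp add: sum_inv_count)
  also have "\<dots> = (\<Sum>U | U \<subseteq> A \<and> card U = m. \<Sum>u\<in>permutations_of_set U. \<Sum>v\<in>permutations_of_set (A - U).
      Q U * (q ^ inv_count u * q ^ inv_count v))"
    using A by (subst sum_permutations_of_set_append[of A m]) (auto simp: Q intro!: sum.cong)
  also have "\<dots> = (\<Sum>U | U \<subseteq> A \<and> card U = m. Q U * (q_fact m q * q_fact n q))"
    using U A by (intro sum.cong refl) (auto simp flip: sum_distrib_left sum_distrib_right simp: sum_inv_count)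
  also have "\<dots> = C * (q_fact m q * q_fact n q)"
    by (simp add: C_def sum_distrib_right)
  finally have fact: "q_fact (m + n) q = C * (q_fact m q * q_fact n q)" .
  have "avoid_weight \<sigma> q A = (\<Sum>U | U \<subseteq> A \<and> card U = m. \<Sum>u\<in>permutations_of_set U. \<Sum>v\<in>permutations_of_set (A - U).
      avoid_term \<sigma> q (u @ v))"
    unfolding avoid_weight_def using A by (intro sum_permutations_of_set_append) auto
  \<comment> \<open>If the concatenation avoids the pattern, so do both blocks; occurrences across
    the cut are disregarded, whence an inequality.\<close>
  also have "\<dots> \<le> (\<Sum>U | U \<subseteq> A \<and> card U = m. \<Sum>u\<in>permutations_of_set U. \<Sum>v\<in>permutations_of_set (A - U).
      Q U * (avoid_term \<sigma> q u * avoid_term \<sigma> q v))"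
    using assms Q by (intro sum_mono) (auto simp: avoid_term_def dest: avoids_append, simp add: Q_def)
  also have "\<dots> = (\<Sum>U | U \<subseteq> A \<and> card U = m. Q U * (avoid_weight \<sigma> q {..<m} * avoid_weight \<sigma> q {..<n}))"
  proof (intro sum.cong refl)
    fix V assume V: "V \<in> {U. U \<subseteq> A \<and> card U = m}"
    have "avoid_weight \<sigma> q {..<m} * avoid_weight \<sigma> q {..<n} = avoid_weight \<sigma> q V * avoid_weight \<sigma> q (A - V)"
      using avoid_weight_card[of V \<sigma> q] avoid_weight_card[of "A - V" \<sigma> q] U[OF V] V A by simp
    then show "(\<Sum>u\<in>permutations_of_set V. \<Sum>v\<in>permutations_of_set (A - V). Q V * (avoid_term \<sigma> q u * avoid_term \<sigma> q v)) =
       Q V * (avoid_weight \<sigma> q {..<m} * avoid_weight \<sigma> q {..<n})"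
      by (simp add: avoid_weight_def sum_distrib_left[symmetric] sum_distrib_right[symmetric])
  qed
  also have "\<dots> = C * (avoid_weight \<sigma> q {..<m} * avoid_weight \<sigma> q {..<n})"
    by (simp add: C_def sum_distrib_right)
  finally have le: "avoid_weight \<sigma> q A \<le> C * (avoid_weight \<sigma> q {..<m} * avoid_weight \<sigma> q {..<n})" .
  have pos: "0 < q_fact m q" "0 < q_fact n q" "0 < q_fact (m + n) q"
    using assms by (simp_all add: q_fact_pos)
  then have "0 < C"
    using fact zero_less_mult_pos2[of C "q_fact m q * q_fact n q"] by simp
  have "avoid_prob (m + n) \<sigma> q \<le> C * (avoid_weight \<sigma> q {..<m} * avoid_weight \<sigma> q {..<n}) / q_fact (m + n) q"
    unfolding avoid_prob_eq A_def[symmetric] using le pos by (intro divide_right_mono) auto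
  also have "\<dots> = avoid_prob m \<sigma> q * avoid_prob n \<sigma> q"
    unfolding avoid_prob_eq_card fact using \<open>0 < C\<close> by simp
  finally show ?thesis .
qed

text \<open>Fekete's lemma in multiplicative form, the limit being the infimum \<open>L\<close> of
  the roots. The bound by 1 allows the remainder of a division by \<open>m\<close> to be
  discarded.\<close>

lemma convergent_root_submultiplicative:
  fixes a :: "nat \<Rightarrow> real"
  assumes pos: "\<And>n. 0 < a n" and le1: "\<And>n. a n \<le> 1"
    and submult: "\<And>m n. a (m + n) \<le> a m * a n"
  shows "convergent (\<lambda>n. root n (a n))"
proof -
  \<comment> \<open>Index 0 is excluded because \<open>root 0\<close> is constantly 0.\<close>
  define L where "L = (INF n\<in>{1..}. root n (a n))"
  have nonneg: "0 \<le> root n (a n)" for n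
    using pos[of n] by (cases "n = 0") (auto intro: real_root_ge_zero less_imp_le)
  then have bdd: "bdd_below ((\<lambda>n. root n (a n)) ` {1..})"
    by (intro bdd_belowI[of _ 0]) auto
  have pow: "a (k * m) \<le> a m ^ k" for k m
  proof (induction k)
    case 0
    show ?case using le1 by simp
  next
    case (Suc k)
    have "a (Suc k * m) \<le> a m * a (k * m)" using submult[of m "k * m"] by simp
    also have "\<dots> \<le> a m * a m ^ k" using Suc pos[of m] by (intro mult_left_mono) auto
    finally show ?case by simp
  qed
  have "(\<lambda>n. root n (a n)) \<longlonglongrightarrow> L"
  proof (rule order_tendstoI)
    fix y assume "y < L"
    have "y < root n (a n)" if "n \<ge> 1" for n
      using \<open>y < L\<close> cINF_lower[OF bdd, of n] that by (auto simp: L_def)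
    then show "\<forall>\<^sub>F n in sequentially. y < root n (a n)"
      by (auto simp: eventually_sequentially)
  next
    fix y assume "L < y"
    then obtain m where m: "m \<ge> 1" "root m (a m) < y"
      unfolding L_def using bdd by (subst (asm) cINF_less_iff) auto
    define c where "c = root m (a m)"
    have c: "0 < c" "c \<le> 1" "c ^ m = a m"
      using m pos[of m] le1[of m] by (auto simp: c_def)
    \<comment> \<open>With k = n div m the product k m is at least n - m, and c \<le> 1 gives a n
      \<le> c^(n-m). The exponent (n - m)/n then tends to 1.\<close>
    have bound: "root n (a n) \<le> c powr (1 - real m / real n)" if n: "n \<ge> m" for n
    proof -
      define k where "k = n div m"
      have km: "k * m \<le> n" "n - m \<le> k * m"
        using m div_mult_mod_eq[of n m] mod_less_divisor[of m n] unfolding k_def by linarith+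
      have "a n \<le> a (k * m) * a (n - k * m)"
        using submult[of "k * m" "n - k * m"] km by simp
      also have "\<dots> \<le> a (k * m) * 1"
        using pos[of "k * m"] le1 by (intro mult_left_mono) auto
      also have "\<dots> \<le> a m ^ k"
        using pow[of k m] by simp
      also have "\<dots> = c ^ (k * m)"
        unfolding c(3)[symmetric] power_mult[symmetric] by (simp only: mult.commute)
      also have "\<dots> \<le> c ^ (n - m)"
        using c km by (intro power_decreasing) auto
      finally have "root n (a n) \<le> root n (c ^ (n - m))"
        using n m by simp
      also have "\<dots> = c powr (real (n - m) / real n)"
        using n m c by (simp add: root_powr_inverse powr_realpow[symmetric] powr_powr field_simps)
      also have "real (n - m) / real n = 1 - real m / real n"
        using n m by (simp add: field_simps of_nat_diff)
      finally show ?thesis .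
    qed
    have "(\<lambda>n. c powr (1 - real m / real n)) \<longlonglongrightarrow> c powr (1 - 0)"
      using c by (intro tendsto_intros lim_const_over_n) auto
    then have "(\<lambda>n. c powr (1 - real m / real n)) \<longlonglongrightarrow> c"
      using c by simp
    then have "\<forall>\<^sub>F n in sequentially. c powr (1 - real m / real n) < y"
      using m by (intro order_tendstoD(2)) (auto simp: c_def)
    then show "\<forall>\<^sub>F n in sequentially. root n (a n) < y"
      using eventually_ge_at_top[of m] by eventually_elim (use bound in force)
  qed
  then show ?thesis by (rule convergentI)
qed

section \<open>Reversal of words\<close>

lemma inv_count_snoc: "inv_count (w @ [x]) = inv_count w + length (filter (\<lambda>y. x < y) w)"
  by (induction w) (auto simp: inv_count_Cons)

text \<open>Reversal exchanges inversions and non-inversions, and in a distinct word each pair of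
  positions is exactly one of the two.\<close>

lemma inv_count_rev:
  assumes "distinct w"
  shows "inv_count (rev w) + inv_count w = length w choose 2"
  using assms
proof (induction w)
  case (Cons x w)
  have "length (filter (\<lambda>y. x < y) (rev w)) + length (filter (\<lambda>y. y < x) w) = length w"
  proof -
    have "filter (\<lambda>y. x < y) w = filter (\<lambda>y. \<not> y < x) w"
      using Cons.prems by (intro filter_cong) (auto simp: not_less order_less_le)
    then show ?thesis
      using sum_length_filter_compl[of "\<lambda>y. y < x" w] by (simp add: rev_filter[symmetric])
  qed
  with Cons show ?case
    by (simp add: inv_count_Cons inv_count_snoc numeral_2_eq_2)
qed simp

lemma order_isomorphic_rev: "order_isomorphic (rev xs) (rev ys) \<longleftrightarrow> order_isomorphic xs ys"
proof -
  have *: "order_isomorphic (rev xs) (rev ys)" if "order_isomorphic xs ys" for xs ys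
    using that unfolding order_isomorphic_def by (auto simp: rev_nth)
  show ?thesis using *[of xs ys] *[of "rev xs" "rev ys"] by auto
qed

lemma avoids_rev: "avoids (rev w) (rev \<sigma>) \<longleftrightarrow> avoids w \<sigma>"
proof -
  have *: "avoids w \<sigma>" if "avoids (rev w) (rev \<sigma>)" for w \<sigma>
    unfolding avoids_def
  proof (intro notI, elim exE conjE)
    fix j assume j: "j + length \<sigma> \<le> length w" "order_isomorphic (take (length \<sigma>) (drop j w)) \<sigma>"
    define i where "i = length w - length \<sigma> - j"
    have "take (length \<sigma>) (drop i (rev w)) = rev (take (length \<sigma>) (drop j w))"
      using j by (simp add: i_def drop_rev take_rev drop_take add.commute)
    then have "order_isomorphic (take (length (rev \<sigma>)) (drop i (rev w))) (rev \<sigma>)"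
      using j by (simp add: order_isomorphic_rev)
    moreover have "i + length (rev \<sigma>) \<le> length (rev w)"
      using j by (simp add: i_def)
    ultimately show False
      using that unfolding avoids_def by blast
  qed
  show ?thesis using *[of w \<sigma>] *[of "rev w" "rev \<sigma>"] by auto
qed

lemma power_inverse_inv_count_rev:
  fixes q :: real
  assumes "w \<in> permutations_of_set {1..n}" "0 < q"
  shows "(1 / q) ^ inv_count (rev w) = q ^ inv_count w / q ^ (n choose 2)"
proof -
  have w: "distinct w" "length w = n"
    using assms(1) length_finite_permutations_of_set[OF assms(1)] by (auto simp: permutations_of_set_def)
  then have "q ^ (n choose 2) = q ^ inv_count (rev w) * q ^ inv_count w"
    using inv_count_rev[of w] by (simp flip: power_add)
  then show ?thesis
    using assms(2) by (simp add: power_divide field_simps)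
qed

lemma sum_permutations_of_set_rev:
  "(\<Sum>w\<in>permutations_of_set A. f (rev w)) = (\<Sum>w\<in>permutations_of_set A. f w)"
  by (rule sum.reindex_bij_witness[where i = rev and j = rev]) (auto simp: permutations_of_set_def)

text \<open>Passing to reversed words and 1 / q divides every weight by the same power of q, which
  cancels against the same power in the normalising constant.\<close>

lemma avoid_prob_rev:
  assumes "0 < q"
  shows "avoid_prob n (rev \<sigma>) (1 / q) = avoid_prob n \<sigma> q"
proof -
  have "avoid_weight (rev \<sigma>) (1 / q) {1..n} = avoid_weight \<sigma> q {1..n} / q ^ (n choose 2)"
    unfolding avoid_weight_def sum_divide_distrib
    by (subst sum_permutations_of_set_rev[symmetric], intro sum.cong refl)
      (simp add: avoid_term_def avoids_rev power_inverse_inv_count_rev assms)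
  moreover have "q_fact n (1 / q) = q_fact n q / q ^ (n choose 2)"
  proof -
    have "(\<Sum>\<pi>\<in>permutations_of_set {1..n}. (1 / q) ^ inv_count \<pi>) =
          (\<Sum>\<pi>\<in>permutations_of_set {1..n}. q ^ inv_count \<pi>) / q ^ (n choose 2)"
      unfolding sum_divide_distrib
      by (subst sum_permutations_of_set_rev[symmetric], intro sum.cong refl)
        (simp add: power_inverse_inv_count_rev assms)
    then show ?thesis by (simp add: sum_inv_count)
  qed
  ultimately show ?thesis
    unfolding avoid_prob_eq using assms by simp
qed

lemma growth_rate_rev: "0 < q \<Longrightarrow> growth_rate (rev \<sigma>) (1 / q) = growth_rate \<sigma> q"
  by (simp add: growth_rate_def avoid_prob_rev)

section \<open>Comparison of probabilities and growth rates\<close>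

lemma avoid_prob_132_le_123:
  assumes "q \<ge> 1"
  shows "avoid_prob n [1,3,2] q \<le> avoid_prob n [1,2,3] q"
  unfolding avoid_prob_eq using assms q_fact_pos[of q n]
  by (intro divide_right_mono avoid_weight_132_le_123) auto

text \<open>Since \<open>growth_rate\<close> is a \<open>lim\<close>, both limits must be shown to
  exist before the inequality can pass to them. Positivity for 123 is inherited from 132 through the
  comparison.\<close>

lemma growth_rate_132_le_123:
  assumes "q \<ge> 1"
  shows "growth_rate [1,3,2] q \<le> growth_rate [1,2,3] q"
proof -
  have q: "0 < q" using assms by simp
  have pos: "0 < avoid_prob n [1,3,2] q" for n
    unfolding avoid_prob_eq using q by (intro divide_pos_pos avoid_weight_132_pos q_fact_pos) auto
  then have pos': "0 < avoid_prob n [1,2,3] q" for n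
    using avoid_prob_132_le_123[OF assms, of n] by (rule less_le_trans)
  have "convergent (\<lambda>n. root n (avoid_prob n [1,3,2] q))"
    by (intro convergent_root_submultiplicative pos avoid_prob_le_1 avoid_prob_submult q)
  moreover have "convergent (\<lambda>n. root n (avoid_prob n [1,2,3] q))"
    by (intro convergent_root_submultiplicative pos' avoid_prob_le_1 avoid_prob_submult q)
  moreover have "root n (avoid_prob n [1,3,2] q) \<le> root n (avoid_prob n [1,2,3] q)" for n
    using avoid_prob_132_le_123[OF assms, of n] by (cases "n = 0") auto
  ultimately show ?thesis
    unfolding growth_rate_def convergent_LIMSEQ_iff by (blast intro: LIMSEQ_le)
qed

theorem theorem6p1:
  shows "(\<forall>q\<ge>1. \<forall>n\<ge>1. avoid_prob n [1,3,2] q \<le> avoid_prob n [1,2,3] q) \<and>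
         (\<forall>q\<ge>1. growth_rate [1,3,2] q \<le> growth_rate [1,2,3] q) \<and>
         (\<forall>q. 0 < q \<and> q \<le> 1 \<longrightarrow> (\<forall>n. avoid_prob n [2,3,1] q \<le> avoid_prob n [3,2,1] q)) \<and>
         (\<forall>q. 0 < q \<and> q \<le> 1 \<longrightarrow> growth_rate [2,3,1] q \<le> growth_rate [3,2,1] q)"
proof (intro conjI allI impI)
  fix q :: real and n :: nat
  assume q: "0 < q \<and> q \<le> 1"
  \<comment> \<open>Here 1 / q is at least 1, and the reversals of 231 and 321 are 132 and
    123.\<close>
  then have "avoid_prob n (rev [2,3,1]) (1 / q) \<le> avoid_prob n (rev [3,2,1]) (1 / q)"
    using avoid_prob_132_le_123[of "1 / q" n] by simp
  with q show "avoid_prob n [2,3,1] q \<le> avoid_prob n [3,2,1] q"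
    by (simp only: avoid_prob_rev)
next
  fix q :: real
  assume q: "0 < q \<and> q \<le> 1"
  then have "growth_rate (rev [2,3,1]) (1 / q) \<le> growth_rate (rev [3,2,1]) (1 / q)"
    using growth_rate_132_le_123[of "1 / q"] by simp
  with q show "growth_rate [2,3,1] q \<le> growth_rate [3,2,1] q"
    by (simp only: growth_rate_rev)
qed (simp_all only: avoid_prob_132_le_123 growth_rate_132_le_123)

end
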